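(* Let $n,m\in\mathbb{N}$, and let $\Phi\in\mathbb{K}^{n\times m}$ be a frame for $\mathbb{K}^n$ with singular values $\sigma_1\ge\sigma_2\ge\dots\ge\sigma_n>0$. Set $r=m-n$. Suppose $\Psi$ is any dual frame of $\Phi$ with singular values $\sigma_1^\Psi\ge\dots\ge\sigma_n^\Psi$. Then the following inequalities hold: $$\frac{1}{\sigma_{n-i+1}}\le\sigma_i^\Psi\qquad\text{for } i=1,\dots,\min\{r,n\},\tag{1}$$ $$\frac{1}{\sigma_{n-i+1}}\le\sigma_i^\Psi\le\frac{1}{\sigma_{n-i+r+1}}\qquad\text{for } i=r+1,\dots,n,\tag{2}$$ where (2) is void if $r\ge n$. Furthermore, for every non-increasing sequence $(\sigma_i^\Psi)_{i=1}^n$ of real numbers satisfying (1) and (2), there is a dual frame $\Psi$ of $\Phi$ with singular values $(\sigma_i^\Psi)_{i=1}^n$.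
   Context: $\mathbb{K}$ denotes $\mathbb{R}$ or $\mathbb{C}$. A frame for $\mathbb{K}^n$ with $m$ vectors is a family $(\phi_i)_{i=1}^m$ in $\mathbb{K}^n$ for which there are constants $0<A\le B$ with $A\|x\|_2^2\le\sum_{i=1}^m|\langle x,\phi_i\rangle|^2\le B\|x\|_2^2$ for all $x\in\mathbb{K}^n$ (so $m\ge n$); it is identified with the $n\times m$ synthesis matrix $\Phi$ whose columns are the $\phi_i$. The singular values of a frame are the $n$ singular values of its $n\times m$ matrix, counted with multiplicity. A dual frame of $\Phi$ is a frame $\Psi\in\mathbb{K}^{n\times m}$ for $\mathbb{K}^n$ with $\Psi\Phi^*=I_n$ (equivalently $\Phi\Psi^*=I_n$). *)

theory Defs
  imports
    "HOL-Computational_Algebra.Fundamental_Theorem_Algebra"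
    "Jordan_Normal_Form.Schur_Decomposition"
begin

text \<open>
  The scalar field is a set \<open>K\<close> of complex numbers, meant to be \<open>\<real>\<close> or \<open>UNIV\<close>; vectors and
  matrices over \<open>K\<close> are complex vectors and matrices whose entries lie in \<open>K\<close>.
\<close>

definition K_vec :: "complex set \<Rightarrow> nat \<Rightarrow> complex vec set"
  where "K_vec K n = {x \<in> carrier_vec n. \<forall>i<n. x $ i \<in> K}"

definition K_mat :: "complex set \<Rightarrow> nat \<Rightarrow> nat \<Rightarrow> complex mat set"
  where "K_mat K n m = {A \<in> carrier_mat n m. \<forall>i<n. \<forall>j<m. A $$ (i, j) \<in> K}"

text \<open>The operation \<open>x \<bullet>c y\<close> conjugates its second argument.\<close>

definition is_frame :: "complex set \<Rightarrow> nat \<Rightarrow> nat \<Rightarrow> complex mat \<Rightarrow> bool"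
  where "is_frame K n m \<Phi> \<longleftrightarrow> \<Phi> \<in> K_mat K n m \<and>
    (\<exists>A B :: real. 0 < A \<and> A \<le> B \<and>
      (\<forall>x \<in> K_vec K n.
        A * (\<Sum>k<n. (cmod (x $ k))\<^sup>2) \<le> (\<Sum>i<m. (cmod (x \<bullet>c col \<Phi> i))\<^sup>2) \<and>
        (\<Sum>i<m. (cmod (x \<bullet>c col \<Phi> i))\<^sup>2) \<le> B * (\<Sum>k<n. (cmod (x $ k))\<^sup>2)))"

definition is_dual_frame :: "complex set \<Rightarrow> nat \<Rightarrow> nat \<Rightarrow> complex mat \<Rightarrow> complex mat \<Rightarrow> bool"
  where "is_dual_frame K n m \<Phi> \<Psi> \<longleftrightarrow> is_frame K n m \<Psi> \<and> \<Psi> * mat_adjoint \<Phi> = 1\<^sub>m n"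

text \<open>
  For an \<open>n \<times> m\<close> matrix \<open>A\<close> with \<open>n \<le> m\<close>, the \<open>n\<close> singular values in non-increasing order: the
  square roots of the eigenvalues of \<open>A A\<^sup>*\<close>, with multiplicity.  These eigenvalues are
  non-negative reals, so taking real parts loses nothing.
\<close>

definition singular_values :: "complex mat \<Rightarrow> real list"
  where "singular_values A =
    rev (sorted_list_of_multiset
      (image_mset (\<lambda>z. sqrt (Re z)) (proots (char_poly (A * mat_adjoint A)))))"

text \<open>Singular values are numbered from \<open>1\<close>.\<close>

definition sing_val :: "complex mat \<Rightarrow> nat \<Rightarrow> real"
  where "sing_val A i = singular_values A ! (i - 1)"

lemma length_singular_values:
  assumes "A \<in> carrier_mat n m"
  shows "length (singular_values A) = n"
proof -
  have "A * mat_adjoint A \<in> carrier_mat n n"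
    using assms by (auto simp: mat_adjoint_def)
  then have "degree (char_poly (A * mat_adjoint A)) = n"
    using degree_monic_char_poly by blast
  then show ?thesis
    by (simp add: singular_values_def size_proots_complex flip: size_mset)
qed

text \<open>
  The inequalities for non-increasing sequences \<open>\<sigma>\<close> (of the frame) and \<open>\<tau>\<close> (of the dual), both
  indexed by \<open>1, \<dots>, n\<close>.
\<close>

definition dual_bounds :: "nat \<Rightarrow> nat \<Rightarrow> (nat \<Rightarrow> real) \<Rightarrow> (nat \<Rightarrow> real) \<Rightarrow> bool"
  where "dual_bounds n r \<sigma> \<tau> \<longleftrightarrow>
    (\<forall>i \<in> {1..min r n}. 1 / \<sigma> (n - i + 1) \<le> \<tau> i) \<and>
    (\<forall>i \<in> {r + 1..n}. 1 / \<sigma> (n - i + 1) \<le> \<tau> i \<and> \<tau> i \<le> 1 / \<sigma> (n - i + r + 1))"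

end

theory Submission
  imports Defs "HOL-Analysis.L2_Norm" "HOL-Combinatorics.Permutations"
begin

text \<open>
  Let \<open>\<Psi> \<Phi>\<^sup>* = I\<close>. The lower bounds follow from \<open>|x|\<^sup>2 = \<langle>\<Psi>\<^sup>* x, \<Phi>\<^sup>* x\<rangle> \<le> |\<Psi>\<^sup>* x| |\<Phi>\<^sup>* x|\<close>, where a dimension
  count makes \<open>x\<close> orthogonal to the leading left singular vectors of both frames. The upper bounds
  follow from \<open>|y|\<^sup>2 = \<langle>x, z\<rangle> \<le> |x| |z|\<close> for \<open>y = \<Psi>\<^sup>* x = \<Phi>\<^sup>* z\<close>, where \<open>x\<close> and \<open>z\<close> are orthogonal to
  the trailing left singular vectors.

  Conversely, the dual frames of \<open>\<Phi>\<close> realize exactly the matrices \<open>\<Psi> \<Psi>\<^sup>* = (\<Phi> \<Phi>\<^sup>*)\<^sup>-\<^sup>1 + V V\<^sup>*\<close> with \<open>V\<close> having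
  \<open>r\<close> columns. A prescribed spectrum is reached by \<open>r\<close> rank-one updates, each of which can realize
  any spectrum that interlaces the current one.
\<close>

section \<open>Adjoints and norms\<close>

text \<open>Matrices are complex even when \<open>K\<close> is \<open>\<real>\<close>, so kernel
  vectors, eigenvectors and the perturbation \<open>V\<close> must all be found with entries in
  \<open>K\<close>. The base is that a singular matrix over \<open>K\<close> has a kernel vector
  over \<open>K\<close>; dimension counts, orthonormal completion and the spectral theorem rest on
  it.

  The Gram matrices of duals have the stated form because two duals differ by some \<open>L\<close>
  with \<open>L \<Phi>\<^sup>* = 0\<close>: the columns of the adjoint of \<open>L\<close> lie in
  the \<open>r\<close>-dimensional kernel of \<open>\<Phi>\<close>, while those of the adjoint of
  \<open>S\<^sup>-\<^sup>1 \<Phi>\<close>, where \<open>S = \<Phi> \<Phi>\<^sup>*\<close>, are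
  orthogonal to it, so no cross terms arise.

  For squares the bounds read \<open>lam i \<le> mu i\<close> and
  \<open>mu i \<le> lam (i - r)\<close>, which is interlacing when \<open>r = 1\<close>. Adding
  \<open>s s\<^sup>*\<close> to a diagonal matrix subtracts from \<open>\<Prod> (x - lam i)\<close>
  a combination of its products with one factor omitted, with weights \<open>c i\<close> equal to
  the squared moduli of the entries of \<open>s\<close>. Computing these weights as residues would
  divide by differences \<open>lam i - lam j\<close>, which may vanish; they are built by induction
  from a polynomial identity that tolerates repeated eigenvalues.\<close>

declare index_mult_mat(1) [simp del] index_mult_mat_vec [simp del]
declare mult_mat_vec_carrier [intro] mult_carrier_mat [intro]

lemma adj_dim [simp]:
  "dim_row (mat_adjoint A) = dim_col A" "dim_col (mat_adjoint A) = dim_row A"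
  by (auto simp: mat_adjoint_def)

lemma adj_carrier [intro, simp]: "A \<in> carrier_mat n m \<Longrightarrow> mat_adjoint A \<in> carrier_mat m n"
  by auto

lemma adj_index [simp]:
  "i < dim_col A \<Longrightarrow> j < dim_row A \<Longrightarrow> mat_adjoint A $$ (i, j) = cnj (A $$ (j, i))"
  by (simp add: mat_adjoint_def mat_of_rows_index)

lemma adj_adj [simp]: "mat_adjoint (mat_adjoint A) = (A :: complex mat)"
  by (rule eq_matI) auto

lemma adj_one [simp]: "mat_adjoint (1\<^sub>m n) = (1\<^sub>m n :: complex mat)"
  by (rule eq_matI) auto

lemma adj_zero [simp]: "mat_adjoint (0\<^sub>m n m) = (0\<^sub>m m n :: complex mat)"
  by (rule eq_matI) auto

lemma adj_mult:
  fixes A B :: "complex mat"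
  assumes "A \<in> carrier_mat n k" "B \<in> carrier_mat k m"
  shows "mat_adjoint (A * B) = mat_adjoint B * mat_adjoint A"
  by (rule eq_matI) (use assms in \<open>auto simp: scalar_prod_def mult.commute index_mult_mat(1)\<close>)

lemma adj_add:
  fixes A B :: "complex mat"
  assumes "A \<in> carrier_mat n m" "B \<in> carrier_mat n m"
  shows "mat_adjoint (A + B) = mat_adjoint A + mat_adjoint B"
  by (rule eq_matI) (use assms in auto)

lemma cscalar_prod_sum:
  fixes x y :: "complex vec"
  shows "dim_vec y = n \<Longrightarrow> x \<bullet>c y = (\<Sum>k<n. x $ k * cnj (y $ k))"
  by (auto simp: scalar_prod_def atLeast0LessThan)

lemma cscalar_prod_cnj:
  fixes x y :: "complex vec"
  assumes "x \<in> carrier_vec n" "y \<in> carrier_vec n"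
  shows "y \<bullet>c x = cnj (x \<bullet>c y)"
  using assms by (simp add: cscalar_prod_sum[of _ n] mult.commute)

lemma mult_mat_vec_index:
  "A \<in> carrier_mat n m \<Longrightarrow> x \<in> carrier_vec m \<Longrightarrow> i < n \<Longrightarrow>
    (A *\<^sub>v x) $ i = (\<Sum>k<m. A $$ (i, k) * x $ k)"
  by (auto simp: index_mult_mat(1) index_mult_mat_vec scalar_prod_def atLeast0LessThan intro!: sum.cong)

lemma mult_mat_index:
  "A \<in> carrier_mat n k \<Longrightarrow> B \<in> carrier_mat k m \<Longrightarrow> i < n \<Longrightarrow> j < m \<Longrightarrow>
    (A * B) $$ (i, j) = (\<Sum>l<k. A $$ (i, l) * B $$ (l, j))"
  by (auto simp: index_mult_mat(1) index_mult_mat_vec scalar_prod_def atLeast0LessThan intro!: sum.cong)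

lemma mult_mat_vec_zero: "A \<in> carrier_mat n m \<Longrightarrow> A *\<^sub>v 0\<^sub>v m = 0\<^sub>v n"
  by (rule eq_vecI) (auto simp: index_mult_mat_vec)

lemma cscalar_prod_adj:
  fixes A :: "complex mat"
  assumes "A \<in> carrier_mat n m" "x \<in> carrier_vec m" "y \<in> carrier_vec n"
  shows "(A *\<^sub>v x) \<bullet>c y = x \<bullet>c (mat_adjoint A *\<^sub>v y)"
proof -
  have "(A *\<^sub>v x) \<bullet>c y = (\<Sum>i<n. \<Sum>k<m. A $$ (i, k) * x $ k * cnj (y $ i))"
    using assms by (simp add: cscalar_prod_sum[of _ n] mult_mat_vec_index[of _ n m] sum_distrib_right)
  also have "\<dots> = (\<Sum>k<m. \<Sum>i<n. A $$ (i, k) * x $ k * cnj (y $ i))"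
    by (rule sum.swap)
  also have "\<dots> = x \<bullet>c (mat_adjoint A *\<^sub>v y)"
    using assms by (simp add: cscalar_prod_sum[of _ m] mult_mat_vec_index[of _ m n] sum_distrib_left
        mult_ac)
  finally show ?thesis .
qed

lemma sum_lessThan_add:
  fixes f :: "nat \<Rightarrow> 'a :: comm_monoid_add"
  shows "(\<Sum>i<k + l. f i) = (\<Sum>i<k. f i) + (\<Sum>i<l. f (k + i))"
  by (induction l) (auto simp: add.assoc)

text \<open>Real-valued, since \<open>x \<bullet>c x\<close> is a complex number and the estimates
  need an order.\<close>

definition sqnorm :: "complex vec \<Rightarrow> real"
  where "sqnorm x = (\<Sum>k<dim_vec x. (cmod (x $ k))\<^sup>2)"

lemma sqnorm_cscalar: "x \<bullet>c x = complex_of_real (sqnorm x)"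
  by (simp add: cscalar_prod_sum sqnorm_def flip: complex_norm_square)

lemma sqnorm_nonneg [simp]: "0 \<le> sqnorm x"
  by (simp add: sqnorm_def sum_nonneg)

lemma sqnorm_pos: "x \<in> carrier_vec n \<Longrightarrow> x \<noteq> 0\<^sub>v n \<Longrightarrow> 0 < sqnorm x"
proof -
  assume x: "x \<in> carrier_vec n" "x \<noteq> 0\<^sub>v n"
  then obtain k where k: "k < n" "x $ k \<noteq> 0" by (metis carrier_vecD eq_vecI index_zero_vec)
  show ?thesis unfolding sqnorm_def
    by (rule sum_pos2[of _ k]) (use x k in auto)
qed

lemma cauchy_schwarz_vec:
  assumes "x \<in> carrier_vec n" "y \<in> carrier_vec n"
  shows "cmod (x \<bullet>c y) \<le> sqrt (sqnorm x) * sqrt (sqnorm y)"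
proof -
  have "cmod (x \<bullet>c y) \<le> (\<Sum>k<n. \<bar>cmod (x $ k)\<bar> * \<bar>cmod (y $ k)\<bar>)"
    using assms by (auto simp: cscalar_prod_sum[of _ n] norm_mult intro!: sum_norm_le)
  also have "\<dots> \<le> L2_set (\<lambda>k. cmod (x $ k)) {..<n} * L2_set (\<lambda>k. cmod (y $ k)) {..<n}"
    by (rule L2_set_mult_ineq)
  finally show ?thesis using assms by (simp add: L2_set_def sqnorm_def)
qed

lemma sqnorm_adj_mult:
  assumes "A \<in> carrier_mat n m" "x \<in> carrier_vec n"
  shows "complex_of_real (sqnorm (mat_adjoint A *\<^sub>v x)) = x \<bullet>c ((A * mat_adjoint A) *\<^sub>v x)"
proof -
  have "complex_of_real (sqnorm (mat_adjoint A *\<^sub>v x)) = (mat_adjoint A *\<^sub>v x) \<bullet>c (mat_adjoint A *\<^sub>v x)"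
    by (simp add: sqnorm_cscalar)
  also have "\<dots> = x \<bullet>c (A *\<^sub>v (mat_adjoint A *\<^sub>v x))"
    using assms by (subst cscalar_prod_adj[of _ m n]) auto
  finally show ?thesis using assms by (simp add: assoc_mult_mat_vec[of _ n m _ n])
qed

lemma sqnorm_adj_frame:
  assumes "A \<in> carrier_mat n m" "x \<in> carrier_vec n"
  shows "(\<Sum>i<m. (cmod (x \<bullet>c col A i))\<^sup>2) = sqnorm (mat_adjoint A *\<^sub>v x)"
proof -
  have "(mat_adjoint A *\<^sub>v x) $ i = cnj (col A i \<bullet>c x)" if "i < m" for i
    using assms that by (simp add: mult_mat_vec_index[of _ m n] cscalar_prod_sum[of _ n])
  moreover have "cmod (cnj (col A i \<bullet>c x)) = cmod (x \<bullet>c col A i)" if "i < m" for i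
    using assms that
    by (simp add: cscalar_prod_sum[of _ n] mult.commute cong: sum.cong)
  ultimately show ?thesis using assms by (simp add: sqnorm_def)
qed

section \<open>Real diagonal matrices, unitary matrices and diagonalized quadratic forms\<close>

definition rdiag :: "nat \<Rightarrow> (nat \<Rightarrow> real) \<Rightarrow> complex mat"
  where "rdiag n d = mat n n (\<lambda>(i, j). if i = j then complex_of_real (d i) else 0)"

lemma rdiag_carrier [simp, intro]: "rdiag n d \<in> carrier_mat n n"
  by (simp add: rdiag_def)

lemma rdiag_dim [simp]: "dim_row (rdiag n d) = n" "dim_col (rdiag n d) = n"
  by (simp_all add: rdiag_def)

lemma rdiag_index [simp]:
  "i < n \<Longrightarrow> j < n \<Longrightarrow> rdiag n d $$ (i, j) = (if i = j then complex_of_real (d i) else 0)"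
  by (simp add: rdiag_def)

lemma rdiag_adj [simp]: "mat_adjoint (rdiag n d) = rdiag n d"
  by (rule eq_matI) auto

lemma rdiag_mult: "rdiag n d * rdiag n e = rdiag n (\<lambda>i. d i * e i)"
  by (rule eq_matI) (auto simp: mult_mat_index[of _ n n _ n] if_distrib[where f = "\<lambda>x. _ * x"]
      if_distrib[where f = "\<lambda>x. x * _"] cong: if_cong)

lemma rdiag_one: "(\<And>i. i < n \<Longrightarrow> d i = 1) \<Longrightarrow> rdiag n d = 1\<^sub>m n"
  by (rule eq_matI) auto

lemma rdiag_mult_vec:
  "x \<in> carrier_vec n \<Longrightarrow> rdiag n d *\<^sub>v x = vec n (\<lambda>i. complex_of_real (d i) * x $ i)"
  by (rule eq_vecI) (auto simp: mult_mat_vec_index[of _ n n] if_distrib[where f = "\<lambda>x. x * _"]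
      cong: if_cong)

definition unitary_mat :: "nat \<Rightarrow> complex mat \<Rightarrow> bool"
  where "unitary_mat n U \<longleftrightarrow> U \<in> carrier_mat n n \<and> mat_adjoint U * U = 1\<^sub>m n \<and> U * mat_adjoint U = 1\<^sub>m n"

lemma unitary_matI:
  "U \<in> carrier_mat n n \<Longrightarrow> mat_adjoint U * U = 1\<^sub>m n \<Longrightarrow> unitary_mat n U"
  unfolding unitary_mat_def using mat_mult_left_right_inverse[of "mat_adjoint U" n U] by auto

lemma sqnorm_unitary_adj:
  assumes "unitary_mat n U" "x \<in> carrier_vec n"
  shows "sqnorm (mat_adjoint U *\<^sub>v x) = sqnorm x"
proof -
  have "complex_of_real (sqnorm (mat_adjoint U *\<^sub>v x)) = complex_of_real (sqnorm x)"
    using assms by (subst sqnorm_adj_mult[of _ n n]) (auto simp: unitary_mat_def sqnorm_cscalar)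
  then show ?thesis by simp
qed

text \<open>In the coordinates of \<open>x\<close> with respect to the columns of \<open>U\<close>,
  the quadratic form of \<open>A * mat_adjoint A\<close> is a weighted sum of squares. All singular
  value estimates are read off from this sum.\<close>

lemma sqnorm_adj_spectral:
  assumes A: "A \<in> carrier_mat n m" and U: "unitary_mat n U"
    and eq: "A * mat_adjoint A = U * rdiag n d * mat_adjoint U"
    and x: "x \<in> carrier_vec n"
  shows "sqnorm (mat_adjoint A *\<^sub>v x) = (\<Sum>i<n. d i * (cmod ((mat_adjoint U *\<^sub>v x) $ i))\<^sup>2)"
proof -
  let ?y = "mat_adjoint U *\<^sub>v x"
  have U': "U \<in> carrier_mat n n" using U by (simp add: unitary_mat_def)
  have y: "?y \<in> carrier_vec n" using U' x by auto
  have "complex_of_real (sqnorm (mat_adjoint A *\<^sub>v x)) = x \<bullet>c ((U * rdiag n d * mat_adjoint U) *\<^sub>v x)"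
    using sqnorm_adj_mult[OF A x] eq by simp
  also have "(U * rdiag n d * mat_adjoint U) *\<^sub>v x = U *\<^sub>v (rdiag n d *\<^sub>v ?y)"
    using U' x y by (simp add: assoc_mult_mat_vec[of _ n n _ n])
  also have "x \<bullet>c \<dots> = ?y \<bullet>c (rdiag n d *\<^sub>v ?y)"
    using cscalar_prod_adj[of "mat_adjoint U" n n x "rdiag n d *\<^sub>v ?y"] U' x y
      mult_mat_vec_carrier[OF rdiag_carrier y] by simp
  also have "\<dots> = (\<Sum>i<n. complex_of_real (d i) * (?y $ i * cnj (?y $ i)))"
    using y by (simp add: rdiag_mult_vec cscalar_prod_sum[of _ n] mult_ac)
  also have "\<dots> = complex_of_real (\<Sum>i<n. d i * (cmod (?y $ i))\<^sup>2)"
    by (simp only: complex_norm_square[symmetric] of_real_sum of_real_mult)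
  finally show ?thesis using of_real_eq_iff by blast
qed

section \<open>Linear algebra over the scalar field\<close>

locale scalar_field =
  fixes K :: "complex set"
  assumes K: "K = \<real> \<or> K = UNIV"
begin

lemma K_of_real [simp, intro]: "complex_of_real x \<in> K"
  using K by auto

lemma K_zero [simp, intro]: "0 \<in> K" and K_one [simp, intro]: "1 \<in> K"
  using K by auto

lemma K_add [intro!]: "x \<in> K \<Longrightarrow> y \<in> K \<Longrightarrow> x + y \<in> K"
  and K_mult [intro!]: "x \<in> K \<Longrightarrow> y \<in> K \<Longrightarrow> x * y \<in> K"
  and K_diff [intro!]: "x \<in> K \<Longrightarrow> y \<in> K \<Longrightarrow> x - y \<in> K"
  and K_cnj [intro!]: "x \<in> K \<Longrightarrow> cnj x \<in> K"
  using K by (auto simp: Reals_cnj_iff)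

lemma K_sum [intro!]: "(\<And>i. i \<in> I \<Longrightarrow> f i \<in> K) \<Longrightarrow> sum f I \<in> K"
  by (induction I rule: infinite_finite_induct) auto

lemma K_vec_carrier: "x \<in> K_vec K n \<Longrightarrow> x \<in> carrier_vec n"
  by (auto simp: K_vec_def)

lemma K_mat_carrier: "A \<in> K_mat K n m \<Longrightarrow> A \<in> carrier_mat n m"
  and K_mat_index: "A \<in> K_mat K n m \<Longrightarrow> i < n \<Longrightarrow> j < m \<Longrightarrow> A $$ (i, j) \<in> K"
  by (auto simp: K_mat_def)

lemma K_mat_mult: "A \<in> K_mat K n k \<Longrightarrow> B \<in> K_mat K k m \<Longrightarrow> A * B \<in> K_mat K n m"
  by (auto simp: K_mat_def mult_mat_index[of _ n k _ m])

lemma K_mat_add: "A \<in> K_mat K n m \<Longrightarrow> B \<in> K_mat K n m \<Longrightarrow> A + B \<in> K_mat K n m"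
  by (auto simp: K_mat_def)

lemma K_mat_adj: "A \<in> K_mat K n m \<Longrightarrow> mat_adjoint A \<in> K_mat K m n"
  by (auto simp: K_mat_def)

lemma K_mat_rdiag: "rdiag n d \<in> K_mat K n n"
  by (auto simp: K_mat_def)

lemma K_mult_mat_vec: "A \<in> K_mat K n m \<Longrightarrow> x \<in> K_vec K m \<Longrightarrow> A *\<^sub>v x \<in> K_vec K n"
  by (auto simp: K_mat_def K_vec_def mult_mat_vec_index[of _ n m])

text \<open>A real matrix that kills a complex vector kills its real and imaginary parts separately,
  and one of the two is non-zero.\<close>

lemma K_kernel:
  assumes B: "B \<in> K_mat K n n" and det: "det B = 0"
  obtains y where "y \<in> K_vec K n" "y \<noteq> 0\<^sub>v n" "B *\<^sub>v y = 0\<^sub>v n"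
proof -
  have Bc: "B \<in> carrier_mat n n" using B by (rule K_mat_carrier)
  obtain v where v: "v \<in> carrier_vec n" "v \<noteq> 0\<^sub>v n" "B *\<^sub>v v = 0\<^sub>v n"
    using det_0_iff_vec_prod_zero[OF Bc] det by auto
  show thesis
  proof (cases "K = UNIV")
    case True
    then show ?thesis using v that[of v] by (auto simp: K_vec_def)
  next
    case False
    then have R: "K = \<real>" using K by auto
    \<comment> \<open>\<open>Re\<close> and \<open>Im\<close> are treated at once: both are additive
      and commute with multiplication by a real number.\<close>
    have part: "B *\<^sub>v vec n (\<lambda>i. complex_of_real (f (v $ i))) = 0\<^sub>v n"
      if f: "f = Re \<or> f = Im" for f :: "complex \<Rightarrow> real"
    proof (rule eq_vecI)
      fix i assume "i < dim_vec (0\<^sub>v n :: complex vec)"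
      then have i: "i < n" by simp
      have add: "f (x + y) = f x + f y" "f 0 = 0" for x y using f by auto
      have fsum: "f (sum g I) = (\<Sum>j\<in>I. f (g j))" for g and I :: "nat set"
        by (induction I rule: infinite_finite_induct) (auto simp: add)
      have fm: "b * complex_of_real (f z) = complex_of_real (f (b * z))" if "b \<in> \<real>" for b z
        using that f by (auto elim!: Reals_cases)
      have "(B *\<^sub>v vec n (\<lambda>i. complex_of_real (f (v $ i)))) $ i
          = (\<Sum>j<n. B $$ (i, j) * complex_of_real (f (v $ j)))"
        using Bc i by (simp add: mult_mat_vec_index[of _ n n])
      also have "\<dots> = (\<Sum>j<n. complex_of_real (f (B $$ (i, j) * v $ j)))"
        using K_mat_index[OF B i] R by (intro sum.cong refl fm) auto
      also have "\<dots> = complex_of_real (f ((B *\<^sub>v v) $ i))"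
        using Bc i v(1) by (simp only: mult_mat_vec_index[of _ n n] fsum of_real_sum)
      finally show "(B *\<^sub>v vec n (\<lambda>i. complex_of_real (f (v $ i)))) $ i = 0\<^sub>v n $ i"
        using i v(3) by (simp add: add)
    qed (use Bc in auto)
    obtain k where k: "k < n" "v $ k \<noteq> 0" using v by (metis carrier_vecD eq_vecI index_zero_vec)
    then have "Re (v $ k) \<noteq> 0 \<or> Im (v $ k) \<noteq> 0" using complex_eq_iff by force
    then obtain f where f: "f = Re \<or> f = Im" "f (v $ k) \<noteq> 0" by auto
    show ?thesis
    proof (rule that)
      show "vec n (\<lambda>i. complex_of_real (f (v $ i))) \<in> K_vec K n" by (simp add: K_vec_def)
      show "B *\<^sub>v vec n (\<lambda>i. complex_of_real (f (v $ i))) = 0\<^sub>v n" by (rule part[OF f(1)])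
      show "vec n (\<lambda>i. complex_of_real (f (v $ i))) \<noteq> 0\<^sub>v n"
        using k f by (metis index_vec index_zero_vec(1) of_real_eq_0_iff)
    qed
  qed
qed

text \<open>Padding with zero rows makes the matrix square; since \<open>k < N\<close>, its last row
  is zero and it is singular. Every dimension count below is an instance.\<close>

lemma K_underdetermined:
  assumes A: "A \<in> K_mat K k N" and "k < N"
  obtains x where "x \<in> K_vec K N" "x \<noteq> 0\<^sub>v N" "A *\<^sub>v x = 0\<^sub>v k"
proof -
  define B where "B = mat N N (\<lambda>(i, j). if i < k then A $$ (i, j) else 0)"
  have B: "B \<in> K_mat K N N" using A by (auto simp: B_def K_mat_def)
  have "det B = 0"
  proof -
    have "B = mat\<^sub>r N N (\<lambda>i. if i = N - 1 then 0\<^sub>v N else row B i)"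
      using \<open>k < N\<close> by (intro eq_matI) (auto simp: B_def)
    then show ?thesis using det_row_0[of "N - 1" N "\<lambda>i. row B i"] \<open>k < N\<close> B
      by (auto simp: K_mat_def)
  qed
  from K_kernel[OF B this] obtain x where x: "x \<in> K_vec K N" "x \<noteq> 0\<^sub>v N" "B *\<^sub>v x = 0\<^sub>v N" .
  have "A *\<^sub>v x = 0\<^sub>v k"
  proof (rule eq_vecI)
    fix i assume "i < dim_vec (0\<^sub>v k :: complex vec)"
    then have i: "i < k" by simp
    have "(A *\<^sub>v x) $ i = (B *\<^sub>v x) $ i"
      using i \<open>k < N\<close> A B x(1)
      by (simp add: mult_mat_vec_index[of _ k N] mult_mat_vec_index[of _ N N] K_mat_def K_vec_def)
        (simp add: B_def)
    then show "(A *\<^sub>v x) $ i = 0\<^sub>v k $ i" using x i \<open>k < N\<close> by simp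
  qed (use A in \<open>auto simp: K_mat_def\<close>)
  then show thesis using that x by blast
qed

lemma K_normalize:
  assumes "x \<in> K_vec K n" "x \<noteq> 0\<^sub>v n"
  obtains c where "complex_of_real c \<cdot>\<^sub>v x \<in> K_vec K n"
    "(complex_of_real c \<cdot>\<^sub>v x) \<bullet>c (complex_of_real c \<cdot>\<^sub>v x) = 1"
proof
  let ?c = "1 / sqrt (sqnorm x)"
  have x: "x \<in> carrier_vec n" and pos: "sqnorm x > 0"
    using assms sqnorm_pos by (auto simp: K_vec_def)
  show "complex_of_real ?c \<cdot>\<^sub>v x \<in> K_vec K n"
    using assms unfolding K_vec_def by (auto intro!: K_mult simp del: of_real_divide)
  have "sqnorm (complex_of_real ?c \<cdot>\<^sub>v x) = ?c\<^sup>2 * sqnorm x"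
    using pos by (simp add: sqnorm_def norm_mult norm_divide power_mult_distrib sum_distrib_left power_divide)
  also have "\<dots> = 1" using pos by (simp add: power_divide)
  finally show "(complex_of_real ?c \<cdot>\<^sub>v x) \<bullet>c (complex_of_real ?c \<cdot>\<^sub>v x) = 1"
    by (simp only: sqnorm_cscalar of_real_1)
qed

section \<open>Orthonormal families over the scalar field\<close>

definition orthonormal :: "nat \<Rightarrow> nat \<Rightarrow> (nat \<Rightarrow> complex vec) \<Rightarrow> bool"
  where "orthonormal N k u \<longleftrightarrow> (\<forall>j<k. u j \<in> K_vec K N) \<and>
    (\<forall>i<k. \<forall>j<k. u i \<bullet>c u j = (if i = j then 1 else 0))"

lemma orthonormal_upd:
  assumes "orthonormal N k u" "x \<in> K_vec K N" "x \<bullet>c x = 1" "\<And>j. j < k \<Longrightarrow> x \<bullet>c u j = 0"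
  shows "orthonormal N (Suc k) (u(k := x))"
proof -
  have "u j \<bullet>c x = 0" if "j < k" for j
  proof -
    have "u j \<bullet>c x = cnj (x \<bullet>c u j)" using assms that
      by (intro cscalar_prod_cnj[of _ N]) (auto simp: orthonormal_def K_vec_def)
    then show ?thesis using assms(4)[OF that] by simp
  qed
  then show ?thesis
    using assms by (auto simp: orthonormal_def less_Suc_eq)
qed

text \<open>Being killed by \<open>C\<close> and orthogonal to \<open>l\<close> earlier vectors is a
  system of \<open>p + l\<close> linear equations, solvable while \<open>p + l < N\<close>. With
  \<open>p = 0\<close> this completes a basis; with \<open>k = 0\<close> and
  \<open>C = \<Phi>\<close> it gives an orthonormal family in the kernel of
  \<open>\<Phi>\<close>.\<close>

lemma orthonormal_extend:
  assumes u: "orthonormal N k u" and C: "C \<in> K_mat K p N" and le: "k \<le> l" "p + l \<le> N"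
  shows "\<exists>u'. orthonormal N l u' \<and> (\<forall>j<k. u' j = u j) \<and> (\<forall>j. k \<le> j \<and> j < l \<longrightarrow> C *\<^sub>v u' j = 0\<^sub>v p)"
  using le
proof (induction l rule: dec_induct)
  case base
  then show ?case using u by auto
next
  case (step l)
  then obtain w where w: "orthonormal N l w" "\<forall>j<k. w j = u j"
    "\<forall>j. k \<le> j \<and> j < l \<longrightarrow> C *\<^sub>v w j = 0\<^sub>v p" by auto
  \<comment> \<open>The lower rows are conjugated so that row \<open>p + j\<close> applied to
    \<open>x\<close> is \<open>x \<bullet>c w j\<close>.\<close>
  define A where "A = mat (p + l) N (\<lambda>(i, j). if i < p then C $$ (i, j) else cnj (w (i - p) $ j))"
  have A: "A \<in> K_mat K (p + l) N"
    using C w(1) by (auto simp: A_def K_mat_def orthonormal_def K_vec_def)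
  obtain x where x: "x \<in> K_vec K N" "x \<noteq> 0\<^sub>v N" "A *\<^sub>v x = 0\<^sub>v (p + l)"
    using K_underdetermined[OF A] step.prems by auto
  obtain c where c: "complex_of_real c \<cdot>\<^sub>v x \<in> K_vec K N"
    "(complex_of_real c \<cdot>\<^sub>v x) \<bullet>c (complex_of_real c \<cdot>\<^sub>v x) = 1"
    using K_normalize[OF x(1,2)] .
  let ?x = "complex_of_real c \<cdot>\<^sub>v x"
  have xc: "x \<in> carrier_vec N" using x(1) by (rule K_vec_carrier)
  have Cx: "C *\<^sub>v x = 0\<^sub>v p"
  proof (rule eq_vecI)
    fix i assume "i < dim_vec (0\<^sub>v p :: complex vec)"
    then have i: "i < p" by simp
    have "(C *\<^sub>v x) $ i = (A *\<^sub>v x) $ i" using i xc C A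
      by (simp add: mult_mat_vec_index[of _ "p + l" N] mult_mat_vec_index[of _ p N] K_mat_def) (simp add: A_def)
    then show "(C *\<^sub>v x) $ i = 0\<^sub>v p $ i" using x(3) i by simp
  qed (use C in \<open>auto simp: K_mat_def\<close>)
  have wx: "x \<bullet>c w j = 0" if "j < l" for j
  proof -
    have "w j \<in> carrier_vec N" using w(1) that by (auto simp: orthonormal_def K_vec_def)
    then have "x \<bullet>c w j = (A *\<^sub>v x) $ (p + j)" using that xc A
      by (simp add: mult_mat_vec_index[of _ "p + l" N] cscalar_prod_sum[of _ N] K_mat_def)
        (simp add: A_def mult.commute)
    then show ?thesis using x(3) that by simp
  qed
  show ?case
  proof (intro exI conjI allI impI)
    show "orthonormal N (Suc l) (w(l := ?x))"
    proof (rule orthonormal_upd[OF w(1) c])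
      fix j assume j: "j < l"
      then have "w j \<in> carrier_vec N" using w(1) by (auto simp: orthonormal_def K_vec_def)
      then show "?x \<bullet>c w j = 0" using wx[OF j] xc by simp
    qed
    show "(w(l := ?x)) j = u j" if "j < k" for j using that w(2) step.hyps by auto
    show "C *\<^sub>v (w(l := ?x)) j = 0\<^sub>v p" if "k \<le> j \<and> j < Suc l" for j
      using that w(3) Cx C xc by (auto simp: less_Suc_eq mult_mat_vec[of _ p N] K_mat_def)
  qed
qed

text \<open>A complex eigenvalue exists by the fundamental theorem of algebra. Hermitian symmetry
  makes it real, so the shifted matrix still has entries in \<open>K\<close> and
  \<open>K_kernel\<close> supplies an eigenvector over \<open>K\<close>.\<close>

lemma hermitian_eigenvector:
  assumes M: "M \<in> K_mat K n n" and herm: "mat_adjoint M = M" and "0 < n"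
  obtains e y where "y \<in> K_vec K n" "y \<noteq> 0\<^sub>v n" "M *\<^sub>v y = complex_of_real e \<cdot>\<^sub>v y"
proof -
  have Mc: "M \<in> carrier_mat n n" using M by (rule K_mat_carrier)
  have "degree (char_poly M) = n" using degree_monic_char_poly[OF Mc] by simp
  then have "\<not> constant (poly (char_poly M))" using \<open>0 < n\<close> by (simp add: constant_degree)
  then obtain z where z: "poly (char_poly M) z = 0" using fundamental_theorem_of_algebra by blast
  then have ev: "eigenvalue M z" using eigenvalue_root_char_poly[OF Mc] by simp
  then obtain v where v: "v \<in> carrier_vec n" "v \<noteq> 0\<^sub>v n" "M *\<^sub>v v = z \<cdot>\<^sub>v v"
    using Mc by (auto simp: eigenvalue_def eigenvector_def)
  have "z * (v \<bullet>c v) = (M *\<^sub>v v) \<bullet>c v" using v by simp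
  also have "\<dots> = v \<bullet>c (M *\<^sub>v v)" using cscalar_prod_adj[OF Mc v(1) v(1)] herm by simp
  also have "\<dots> = cnj z * (v \<bullet>c v)" using v(1) v(3)
    by (simp add: cscalar_prod_sum[of _ n] sum_distrib_left mult_ac)
  finally have "z = cnj z" using sqnorm_pos[OF v(1,2)] by (auto simp: sqnorm_cscalar)
  then have "z \<in> \<real>" by (metis Reals_cnj_iff)
  then obtain e where e: "z = complex_of_real e" by (auto elim: Reals_cases)
  define B where "B = M - z \<cdot>\<^sub>m 1\<^sub>m n"
  have B: "B \<in> K_mat K n n" using M e by (auto simp: B_def K_mat_def)
  have sp: "B *\<^sub>v x = M *\<^sub>v x - z \<cdot>\<^sub>v x" if "x \<in> carrier_vec n" for x
  proof (rule eq_vecI)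
    fix i assume "i < dim_vec (M *\<^sub>v x - z \<cdot>\<^sub>v x)"
    then have i: "i < n" using that by simp
    have "(\<Sum>k<n. (M $$ (i, k) - (if i = k then z else 0)) * x $ k) = (\<Sum>k<n. M $$ (i, k) * x $ k) - z * x $ i"
      using i by (simp add: left_diff_distrib sum_subtractf if_distrib[where f = "\<lambda>x. x * _"] cong: if_cong)
    then show "(B *\<^sub>v x) $ i = (M *\<^sub>v x - z \<cdot>\<^sub>v x) $ i"
      using that Mc i B by (simp add: mult_mat_vec_index[of _ n n] K_mat_def)
        (simp add: B_def if_distrib[where f = "\<lambda>x. z * x"] cong: if_cong)
  qed (use Mc that in \<open>auto simp: B_def\<close>)
  have "B *\<^sub>v v = 0\<^sub>v n" using sp[OF v(1)] v by auto
  then have "det B = 0" using det_0_iff_vec_prod_zero[of B n] v B by (auto simp: K_mat_def)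
  from K_kernel[OF B this] obtain y where y: "y \<in> K_vec K n" "y \<noteq> 0\<^sub>v n" "B *\<^sub>v y = 0\<^sub>v n" .
  have yc: "y \<in> carrier_vec n" using y(1) by (rule K_vec_carrier)
  have "M *\<^sub>v y = z \<cdot>\<^sub>v y"
  proof (rule eq_vecI)
    fix i assume "i < dim_vec (z \<cdot>\<^sub>v y)"
    then have i: "i < n" using yc by simp
    have "(M *\<^sub>v y - z \<cdot>\<^sub>v y) $ i = 0" using i by (simp flip: sp[OF yc] add: y(3))
    then show "(M *\<^sub>v y) $ i = (z \<cdot>\<^sub>v y) $ i" using i yc Mc by simp
  qed (use Mc yc in auto)
  then show thesis using that y e by auto
qed

end

section \<open>The spectral theorem\<close>

lemma char_poly_rdiag: "char_poly (rdiag n d) = (\<Prod>i<n. [:- complex_of_real (d i), 1:])"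
proof -
  have "char_poly (rdiag n d) = (\<Prod>a\<leftarrow>diag_mat (rdiag n d). [:- a, 1:])"
    by (rule char_poly_upper_triangular[of _ n]) auto
  also have "\<dots> = (\<Prod>i\<leftarrow>[0..<n]. [:- complex_of_real (d i), 1:])"
    by (auto simp: diag_mat_def intro!: arg_cong[where f = prod_list])
  also have "\<dots> = (\<Prod>i\<in>set [0..<n]. [:- complex_of_real (d i), 1:])"
    by (rule prod.distinct_set_conv_list[symmetric]) simp
  finally show ?thesis by (simp add: atLeast0LessThan)
qed

lemma proots_prod_real:
  "proots (\<Prod>i<n. [:- complex_of_real (d i), 1:]) = image_mset complex_of_real (mset (map d [0..<n]))"
proof (induction n)
  case (Suc n)
  have "(\<Prod>i<n. [:- complex_of_real (d i), 1:]) \<noteq> 0" by simp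
  then show ?case using Suc by (simp add: proots_mult del: mult_pCons_right mult_pCons_left)
qed simp

text \<open>Reading off the multiset of roots makes it possible to match two eigenvalue lists up to
  a permutation.\<close>

lemma real_roots_unique:
  assumes "(\<Prod>i<n. [:- complex_of_real (c i), 1:]) = (\<Prod>i<n. [:- complex_of_real (d i), 1:])"
  shows "mset (map c [0..<n]) = mset (map d [0..<n])"
proof -
  have "image_mset complex_of_real (mset (map c [0..<n])) = image_mset complex_of_real (mset (map d [0..<n]))"
    using assms proots_prod_real by metis
  from arg_cong[OF this, of "image_mset Re"] show ?thesis
    by (simp add: multiset.map_comp o_def)
qed

context scalar_field
begin

lemma cols_isometry:
  assumes u: "orthonormal N k u"
  defines "U \<equiv> mat N k (\<lambda>(i, j). u j $ i)"
  shows "U \<in> K_mat K N k" "mat_adjoint U * U = 1\<^sub>m k"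
proof -
  show U: "U \<in> K_mat K N k" using u by (auto simp: U_def K_mat_def orthonormal_def K_vec_def)
  have Uc: "U \<in> carrier_mat N k" by (simp add: U_def)
  show "mat_adjoint U * U = 1\<^sub>m k"
  proof (rule eq_matI)
    fix i j assume "i < dim_row (1\<^sub>m k :: complex mat)" "j < dim_col (1\<^sub>m k :: complex mat)"
    then have ij: "i < k" "j < k" by auto
    have "u i \<in> carrier_vec N" using u ij by (auto simp: orthonormal_def K_vec_def)
    then have "(mat_adjoint U * U) $$ (i, j) = u j \<bullet>c u i"
      using ij Uc by (simp add: mult_mat_index[of _ k N _ k] cscalar_prod_sum[of _ N])
        (simp add: U_def mult.commute)
    then show "(mat_adjoint U * U) $$ (i, j) = 1\<^sub>m k $$ (i, j)"
      using u ij by (auto simp: orthonormal_def)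
  qed (use Uc in auto)
qed

lemma cols_unitary:
  assumes "orthonormal n n u"
  defines "U \<equiv> mat n n (\<lambda>(i, j). u j $ i)"
  shows "U \<in> K_mat K n n" "unitary_mat n U"
  using cols_isometry[OF assms(1)] unfolding U_def by (auto intro: unitary_matI)

text \<open>
  Completing \<open>k\<close> orthonormal eigenvectors to an orthonormal basis block-diagonalizes \<open>M\<close>; the next
  eigenvector comes from the lower right block.
\<close>

lemma hermitian_eigenbasis_aux:
  assumes M: "M \<in> K_mat K n n" and herm: "mat_adjoint M = M" and "k \<le> n"
  shows "\<exists>u d. orthonormal n k u \<and> (\<forall>j<k. M *\<^sub>v u j = complex_of_real (d j) \<cdot>\<^sub>v u j)"
  using \<open>k \<le> n\<close>
proof (induction k)
  case 0
  show ?case by (auto simp: orthonormal_def)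
next
  case (Suc k)
  then obtain u0 d where u0: "orthonormal n k u0"
    "\<forall>j<k. M *\<^sub>v u0 j = complex_of_real (d j) \<cdot>\<^sub>v u0 j" by auto
  have Mc: "M \<in> carrier_mat n n" using M by (rule K_mat_carrier)
  have "0\<^sub>m 0 n \<in> K_mat K 0 n" by (simp add: K_mat_def)
  from orthonormal_extend[OF u0(1) this, of n] Suc.prems
  obtain u where u: "orthonormal n n u" "\<forall>j<k. u j = u0 j" by auto
  define Q where "Q = mat n n (\<lambda>(i, j). u j $ i)"
  have Q: "Q \<in> K_mat K n n" "unitary_mat n Q" unfolding Q_def using cols_unitary[OF u(1)] by auto
  have Qc: "Q \<in> carrier_mat n n" using Q(1) by (rule K_mat_carrier)
  have uc: "u j \<in> carrier_vec n" if "j < n" for j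
    using u(1) that by (auto simp: orthonormal_def K_vec_def)
  have colQ: "col Q j = u j" if "j < n" for j
    by (rule eq_vecI) (use that uc[OF that] in \<open>auto simp: Q_def\<close>)
  \<comment> \<open>This is \<open>M\<close> in the basis \<open>u\<close>. Its leading
    \<open>k\<close> columns are diagonal because they come from eigenvectors, and by symmetry the
    upper right block vanishes as well.\<close>
  define N where "N = mat_adjoint Q * (M * Q)"
  have N: "N \<in> K_mat K n n" unfolding N_def by (rule K_mat_mult[OF K_mat_adj[OF Q(1)] K_mat_mult[OF M Q(1)]])
  have Nc: "N \<in> carrier_mat n n" using N by (rule K_mat_carrier)
  have Nherm: "mat_adjoint N = N"
  proof -
    have "mat_adjoint N = mat_adjoint (M * Q) * Q"
      unfolding N_def by (subst adj_mult[of _ n n _ n]) (use Mc Qc in auto)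
    also have "mat_adjoint (M * Q) = mat_adjoint Q * M"
      by (subst adj_mult[of _ n n _ n]) (use Mc Qc herm in auto)
    finally show ?thesis unfolding N_def
      using assoc_mult_mat[of "mat_adjoint Q" n n M n Q n] Mc Qc by simp
  qed
  have N0: "N $$ (i, j) = (if i = j then complex_of_real (d j) else 0)" if "i < n" "j < k" for i j
  proof -
    have j: "j < n" using that Suc.prems by simp
    have "col (M * Q) j = M *\<^sub>v u j" using colQ[OF j] Mc Qc j
      by (intro eq_vecI) (auto simp: index_mult_mat(1) index_mult_mat_vec)
    also have "\<dots> = complex_of_real (d j) \<cdot>\<^sub>v u j" using u0(2) u(2) that by simp
    finally have MQ: "col (M * Q) j = complex_of_real (d j) \<cdot>\<^sub>v u j" .
    have "(M * Q) $$ (l, j) = complex_of_real (d j) * u j $ l" if "l < n" for l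
    proof -
      have "(M * Q) $$ (l, j) = col (M * Q) j $ l" using that j Mc Qc by (subst index_col) auto
      then show ?thesis unfolding MQ using that uc[OF j] by simp
    qed
    then have "N $$ (i, j) = (\<Sum>l<n. cnj (u i $ l) * (complex_of_real (d j) * u j $ l))"
      unfolding N_def using that(1) j Mc Qc
      by (subst mult_mat_index[of _ n n _ n]) (auto intro!: sum.cong simp: Q_def)
    also have "\<dots> = complex_of_real (d j) * (u j \<bullet>c u i)"
      using uc[OF that(1)] by (simp add: cscalar_prod_sum[of _ n] sum_distrib_left mult_ac)
    also have "u j \<bullet>c u i = (if j = i then 1 else 0)" using u(1) that(1) j by (auto simp: orthonormal_def)
    finally show ?thesis by simp
  qed
  have N0': "N $$ (i, j) = 0" if "i < k" "j < n" "k \<le> j" for i j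
  proof -
    have "N $$ (i, j) = mat_adjoint N $$ (i, j)" by (simp add: Nherm)
    also have "\<dots> = cnj (N $$ (j, i))" using Nc that Suc.prems by simp
    finally show ?thesis using N0[of j i] that by simp
  qed
  define B where "B = mat (n - k) (n - k) (\<lambda>(i, j). N $$ (i + k, j + k))"
  have B: "B \<in> K_mat K (n - k) (n - k)" using N by (auto simp: B_def K_mat_def)
  have Bherm: "mat_adjoint B = B"
  proof (rule eq_matI)
    fix i j assume "i < dim_row B" "j < dim_col B"
    then have ij: "i + k < n" "j + k < n" by (auto simp: B_def)
    have "mat_adjoint N $$ (i + k, j + k) = cnj (N $$ (j + k, i + k))" using Nc ij by simp
    then show "mat_adjoint B $$ (i, j) = B $$ (i, j)" using ij Nherm by (simp add: B_def)
  qed (auto simp: B_def)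
  have "0 < n - k" using Suc.prems by simp
  from hermitian_eigenvector[OF B Bherm this]
  obtain e y0 where y0: "y0 \<in> K_vec K (n - k)" "y0 \<noteq> 0\<^sub>v (n - k)" "B *\<^sub>v y0 = complex_of_real e \<cdot>\<^sub>v y0" .
  obtain c where c: "complex_of_real c \<cdot>\<^sub>v y0 \<in> K_vec K (n - k)"
    "(complex_of_real c \<cdot>\<^sub>v y0) \<bullet>c (complex_of_real c \<cdot>\<^sub>v y0) = 1"
    using K_normalize[OF y0(1,2)] .
  define y where "y = complex_of_real c \<cdot>\<^sub>v y0"
  have y: "y \<in> K_vec K (n - k)" "y \<bullet>c y = 1" "B *\<^sub>v y = complex_of_real e \<cdot>\<^sub>v y"
  proof -
    show "y \<in> K_vec K (n - k)" "y \<bullet>c y = 1" using c by (auto simp: y_def)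
    have "B *\<^sub>v y = complex_of_real c \<cdot>\<^sub>v (B *\<^sub>v y0)"
      unfolding y_def by (rule mult_mat_vec) (use B y0 in \<open>auto simp: K_mat_def K_vec_def\<close>)
    then show "B *\<^sub>v y = complex_of_real e \<cdot>\<^sub>v y"
      unfolding y0(3) y_def by (simp add: smult_smult_assoc mult.commute)
  qed
  have yc: "y \<in> carrier_vec (n - k)" using y(1) by (rule K_vec_carrier)
  \<comment> \<open>The \<open>k\<close> leading zeros make \<open>Q *\<^sub>v z\<close> orthogonal
    to the eigenvectors already found, and the block structure makes \<open>z\<close> an eigenvector
    of \<open>N\<close>.\<close>
  define z where "z = vec n (\<lambda>i. if i < k then 0 else y $ (i - k))"
  have z: "z \<in> K_vec K n" using y(1) by (auto simp: z_def K_vec_def)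
  have zc: "z \<in> carrier_vec n" using z by (rule K_vec_carrier)
  have split: "(\<Sum>i<n. f i) = (\<Sum>i<k. f i) + (\<Sum>i<n - k. f (i + k))" for f :: "nat \<Rightarrow> complex"
    using sum_lessThan_add[of f k "n - k"] Suc.prems by (simp add: add.commute)
  have Nz: "N *\<^sub>v z = complex_of_real e \<cdot>\<^sub>v z"
  proof (rule eq_vecI)
    fix i assume "i < dim_vec (complex_of_real e \<cdot>\<^sub>v z)"
    then have i: "i < n" by (simp add: z_def)
    have "(N *\<^sub>v z) $ i = (\<Sum>l<k. N $$ (i, l) * z $ l) + (\<Sum>l<n - k. N $$ (i, l + k) * z $ (l + k))"
      using mult_mat_vec_index[OF Nc zc i] split by simp
    also have "(\<Sum>l<k. N $$ (i, l) * z $ l) = 0" using Suc.prems by (auto simp: z_def intro!: sum.neutral)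
    also have "(\<Sum>l<n - k. N $$ (i, l + k) * z $ (l + k)) = (\<Sum>l<n - k. N $$ (i, l + k) * y $ l)"
      by (auto simp: z_def intro!: sum.cong)
    also have "\<dots> = complex_of_real e * z $ i"
    proof (cases "i < k")
      case True
      then show ?thesis using i N0' by (auto simp: z_def intro!: sum.neutral)
    next
      case False
      have "(\<Sum>l<n - k. N $$ (i, l + k) * y $ l) = (B *\<^sub>v y) $ (i - k)"
        using False i B yc by (simp add: mult_mat_vec_index[of _ "n - k" "n - k"] K_mat_def) (simp add: B_def)
      then show ?thesis using False i yc unfolding y(3) by (simp add: z_def)
    qed
    finally show "(N *\<^sub>v z) $ i = (complex_of_real e \<cdot>\<^sub>v z) $ i" using i zc by simp
  qed (use Nc in \<open>auto simp: z_def\<close>)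
  define x where "x = Q *\<^sub>v z"
  have x: "x \<in> K_vec K n" unfolding x_def by (rule K_mult_mat_vec[OF Q(1) z])
  have xc: "x \<in> carrier_vec n" using x by (rule K_vec_carrier)
  have QQ: "Q * mat_adjoint Q = 1\<^sub>m n" "mat_adjoint Q * Q = 1\<^sub>m n"
    using Q(2) by (auto simp: unitary_mat_def)
  have Qx: "mat_adjoint Q *\<^sub>v x = z" unfolding x_def
    using assoc_mult_mat_vec[of "mat_adjoint Q" n n Q n z] Qc zc QQ by simp
  have xx: "x \<bullet>c x = 1"
  proof -
    have "x \<bullet>c x = z \<bullet>c z" using cscalar_prod_adj[OF Qc zc xc] Qx by (simp add: x_def)
    also have "\<dots> = y \<bullet>c y" using yc zc
      by (simp add: cscalar_prod_sum[of _ n] cscalar_prod_sum[of _ "n - k"] split)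
        (use Suc.prems in \<open>simp add: z_def\<close>)
    finally show ?thesis using y by simp
  qed
  have ux: "x \<bullet>c u j = 0" if "j < k" for j
  proof -
    have j: "j < n" using that Suc.prems by simp
    have "x \<bullet>c u j = (mat_adjoint Q *\<^sub>v x) $ j" using j Qc xc uc[OF j]
      by (simp add: mult_mat_vec_index[of _ n n] cscalar_prod_sum[of _ n]) (simp add: Q_def mult.commute)
    then show ?thesis using that j by (simp add: Qx z_def)
  qed
  have Mx: "M *\<^sub>v x = complex_of_real e \<cdot>\<^sub>v x"
  proof -
    have "Q *\<^sub>v (N *\<^sub>v z) = (Q * N) *\<^sub>v z" using Qc Nc zc by (simp add: assoc_mult_mat_vec[of _ n n _ n])
    also have "Q * N = M * Q" unfolding N_def
      using assoc_mult_mat[of Q n n "mat_adjoint Q" n "M * Q" n] Qc Mc QQ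
        mult_carrier_mat[of M n n Q n] by simp
    also have "(M * Q) *\<^sub>v z = M *\<^sub>v x" unfolding x_def using Qc Mc zc by (simp add: assoc_mult_mat_vec[of _ n n _ n])
    finally show ?thesis unfolding Nz x_def using mult_mat_vec[OF Qc zc] by simp
  qed
  show ?case
  proof (intro exI conjI allI impI)
    show "orthonormal n (Suc k) (u(k := x))"
      by (rule orthonormal_upd) (use u(1) Suc.prems x xx ux in \<open>auto simp: orthonormal_def\<close>)
    show "M *\<^sub>v (u(k := x)) j = complex_of_real ((d(k := e)) j) \<cdot>\<^sub>v (u(k := x)) j" if "j < Suc k" for j
      using that Mx u0(2) u(2) by (auto simp: less_Suc_eq)
  qed
qed

lemma eigenbasis_spectral:
  assumes M: "M \<in> carrier_mat n n" and u: "orthonormal n n u"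
    and ev: "\<forall>j<n. M *\<^sub>v u j = complex_of_real (d j) \<cdot>\<^sub>v u j"
  defines "U \<equiv> mat n n (\<lambda>(i, j). u j $ i)"
  shows "M = U * rdiag n d * mat_adjoint U"
    and "char_poly M = (\<Prod>i<n. [:- complex_of_real (d i), 1:])"
proof -
  have U: "unitary_mat n U" unfolding U_def using cols_unitary[OF u] by auto
  have Uc: "U \<in> carrier_mat n n" by (simp add: U_def)
  have MU: "M * U = U * rdiag n d"
  proof (rule eq_matI)
    fix i j assume "i < dim_row (U * rdiag n d)" "j < dim_col (U * rdiag n d)"
    then have ij: "i < n" "j < n" using Uc by auto
    have uc: "u j \<in> carrier_vec n" using u ij by (auto simp: orthonormal_def K_vec_def)
    have "(M * U) $$ (i, j) = (M *\<^sub>v u j) $ i"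
      using ij M Uc uc by (simp add: mult_mat_index[of _ n n _ n] mult_mat_vec_index[of _ n n]) (simp add: U_def)
    also have "\<dots> = complex_of_real (d j) * u j $ i" using ev ij uc by simp
    also have "\<dots> = (U * rdiag n d) $$ (i, j)" using ij Uc
      by (simp add: mult_mat_index[of _ n n _ n] if_distrib[where f = "\<lambda>x. _ * x"] cong: if_cong) (simp add: U_def)
    finally show "(M * U) $$ (i, j) = (U * rdiag n d) $$ (i, j)" .
  qed (use Uc M in auto)
  have UU: "U * mat_adjoint U = 1\<^sub>m n" "mat_adjoint U * U = 1\<^sub>m n" using U by (auto simp: unitary_mat_def)
  have "M = M * (U * mat_adjoint U)" using UU M by simp
  also have "\<dots> = U * rdiag n d * mat_adjoint U"
    using assoc_mult_mat[OF M Uc, of "mat_adjoint U" n] Uc MU by simp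
  finally show eq: "M = U * rdiag n d * mat_adjoint U" .
  have "similar_mat_wit M (rdiag n d) U (mat_adjoint U)"
    unfolding similar_mat_wit_def Let_def using M Uc UU eq by auto
  then have "char_poly M = char_poly (rdiag n d)" by (intro char_poly_similar) (auto simp: similar_mat_def)
  also have "\<dots> = (\<Prod>i<n. [:- complex_of_real (d i), 1:])" by (rule char_poly_rdiag)
  finally show "char_poly M = (\<Prod>i<n. [:- complex_of_real (d i), 1:])" .
qed

lemma hermitian_spectral:
  assumes M: "M \<in> K_mat K n n" and herm: "mat_adjoint M = M"
  obtains U d where "U \<in> K_mat K n n" "unitary_mat n U" "M = U * rdiag n d * mat_adjoint U"
    "char_poly M = (\<Prod>i<n. [:- complex_of_real (d i), 1:])"
proof -
  obtain u d where u: "orthonormal n n u" "\<forall>j<n. M *\<^sub>v u j = complex_of_real (d j) \<cdot>\<^sub>v u j"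
    using hermitian_eigenbasis_aux[OF M herm, of n] by auto
  show thesis
    using that[OF cols_unitary[OF u(1)] eigenbasis_spectral[OF K_mat_carrier[OF M] u]] .
qed

text \<open>The characteristic polynomial fixes the eigenvalues as a multiset, so permuting an
  eigenbasis yields the diagonal in any prescribed order. The min-max estimates and the rank-one
  updates both depend on that order.\<close>

lemma hermitian_spectral_ordered:
  assumes M: "M \<in> K_mat K n n" and herm: "mat_adjoint M = M"
    and cp: "char_poly M = (\<Prod>i<n. [:- complex_of_real (c i), 1:])"
  obtains U where "U \<in> K_mat K n n" "unitary_mat n U" "M = U * rdiag n c * mat_adjoint U"
proof -
  obtain u d where u: "orthonormal n n u" "\<forall>j<n. M *\<^sub>v u j = complex_of_real (d j) \<cdot>\<^sub>v u j"
    using hermitian_eigenbasis_aux[OF M herm, of n] by auto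
  have "mset (map c [0..<n]) = mset (map d [0..<n])"
    using cp eigenbasis_spectral(2)[OF K_mat_carrier[OF M] u] by (intro real_roots_unique) simp
  then obtain p where p: "p permutes {..<n}" "permute_list p (map d [0..<n]) = map c [0..<n]"
    by (rule mset_eq_permutation) simp
  have pn: "p j < n" if "j < n" for j using permutes_in_image[OF p(1)] that by simp
  have cd: "c j = d (p j)" if "j < n" for j
  proof -
    have "c j = permute_list p (map d [0..<n]) ! j" using p(2) that by simp
    then show ?thesis using that pn[OF that] p(1) by (subst (asm) permute_list_nth) auto
  qed
  have inj: "p i = p j \<longleftrightarrow> i = j" for i j using permutes_inj[OF p(1)] by (auto dest: injD)
  have up: "orthonormal n n (u \<circ> p)" using u(1) pn by (auto simp: orthonormal_def inj)
  have ev: "\<forall>j<n. M *\<^sub>v (u \<circ> p) j = complex_of_real (c j) \<cdot>\<^sub>v (u \<circ> p) j"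
    using u(2) pn cd by auto
  show thesis
    using that[OF cols_unitary[OF up] eigenbasis_spectral(1)[OF K_mat_carrier[OF M] up ev]] .
qed

end

section \<open>Singular values\<close>

lemma singular_values_eq_sort:
  assumes "char_poly (A * mat_adjoint A) = (\<Prod>i<n. [:- complex_of_real (d i), 1:])"
  shows "singular_values A = rev (sort (map (\<lambda>i. sqrt (d i)) [0..<n]))"
proof -
  have "image_mset (\<lambda>z. sqrt (Re z)) (proots (char_poly (A * mat_adjoint A)))
      = mset (map (\<lambda>i. sqrt (d i)) [0..<n])"
    unfolding assms proots_prod_real by (simp add: multiset.map_comp o_def)
  then show ?thesis unfolding singular_values_def by (simp only: sorted_list_of_multiset_mset)
qed

text \<open>Non-negativity cancels the square root against the square, and for a non-increasing
  sequence sorting followed by reversal changes nothing.\<close>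

lemma sing_val_eqI:
  assumes cp: "char_poly (A * mat_adjoint A) = (\<Prod>i<n. [:- complex_of_real ((c i)\<^sup>2), 1:])"
    and nonneg: "\<And>i. i < n \<Longrightarrow> 0 \<le> c i" and anti: "antimono_on {..<n} c" and "i < n"
  shows "sing_val A (Suc i) = c i"
proof -
  have "map (\<lambda>i. sqrt ((c i)\<^sup>2)) [0..<n] = map c [0..<n]" using nonneg by auto
  moreover have "sort (map c [0..<n]) = rev (map c [0..<n])"
    by (rule properties_for_sort)
      (use anti in \<open>auto simp: sorted_wrt_iff_nth_less rev_nth monotone_on_def sorted_rev_iff_nth_mono\<close>)
  ultimately have "singular_values A = map c [0..<n]"
    unfolding singular_values_eq_sort[OF cp] by (simp only: rev_rev_ident)
  then show ?thesis using \<open>i < n\<close> by (simp add: sing_val_def)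
qed

section \<open>Gram matrices and singular values of dual pairs\<close>

lemma dual_adj:
  fixes \<Phi> :: "complex mat"
  assumes "\<Phi> \<in> carrier_mat n m" "\<Psi> \<in> carrier_mat n m" "\<Psi> * mat_adjoint \<Phi> = 1\<^sub>m n"
  shows "\<Phi> * mat_adjoint \<Psi> = 1\<^sub>m n"
  using arg_cong[OF assms(3), of mat_adjoint] adj_mult[of \<Psi> n m "mat_adjoint \<Phi>" n] assms by simp

text \<open>The source of both applications of Cauchy-Schwarz: the lower bounds take
  \<open>z = x\<close>, the upper bounds take \<open>x\<close> and \<open>z\<close> with equal
  images.\<close>

lemma dual_inner:
  fixes \<Phi> :: "complex mat"
  assumes "\<Phi> \<in> carrier_mat n m" "\<Psi> \<in> carrier_mat n m" "\<Psi> * mat_adjoint \<Phi> = 1\<^sub>m n"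
    and "x \<in> carrier_vec n" "z \<in> carrier_vec n"
  shows "(mat_adjoint \<Psi> *\<^sub>v x) \<bullet>c (mat_adjoint \<Phi> *\<^sub>v z) = x \<bullet>c z"
proof -
  have "(mat_adjoint \<Psi> *\<^sub>v x) \<bullet>c (mat_adjoint \<Phi> *\<^sub>v z) = x \<bullet>c (\<Psi> *\<^sub>v (mat_adjoint \<Phi> *\<^sub>v z))"
    using cscalar_prod_adj[of "mat_adjoint \<Psi>" m n x "mat_adjoint \<Phi> *\<^sub>v z"] assms
      mult_mat_vec_carrier[of "mat_adjoint \<Phi>" m n z] by simp
  also have "\<Psi> *\<^sub>v (mat_adjoint \<Phi> *\<^sub>v z) = z"
    using assoc_mult_mat_vec[of \<Psi> n m "mat_adjoint \<Phi>" n z] assms by simp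
  finally show ?thesis .
qed

context scalar_field
begin

lemma gram_hermitian:
  assumes "A \<in> K_mat K n m"
  shows "A * mat_adjoint A \<in> K_mat K n n" "mat_adjoint (A * mat_adjoint A) = A * mat_adjoint A"
  using K_mat_mult[OF assms K_mat_adj[OF assms]]
    adj_mult[OF K_mat_carrier[OF assms] adj_carrier[OF K_mat_carrier[OF assms]]] by auto

text \<open>Exchanges the sorted list in the definition for a factorization of the characteristic
  polynomial, the form in which eigenvalues are handled elsewhere. Indices are shifted by
  \<open>Suc\<close> to start at \<open>0\<close>.\<close>

lemma sing_val_char_poly:
  assumes A: "A \<in> K_mat K n m"
  shows "char_poly (A * mat_adjoint A) = (\<Prod>i<n. [:- complex_of_real ((sing_val A (Suc i))\<^sup>2), 1:])"
    and "antimono_on {..<n} (\<lambda>i. sing_val A (Suc i))"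
    and "i < n \<Longrightarrow> 0 \<le> sing_val A (Suc i)"
proof -
  have Ac: "A \<in> carrier_mat n m" using A by (rule K_mat_carrier)
  obtain U d where U: "unitary_mat n U" "A * mat_adjoint A = U * rdiag n d * mat_adjoint U"
    and cp: "char_poly (A * mat_adjoint A) = (\<Prod>i<n. [:- complex_of_real (d i), 1:])"
    using hermitian_spectral[OF gram_hermitian[OF A]] by metis
  have Uc: "U \<in> carrier_mat n n" and UU: "mat_adjoint U * U = 1\<^sub>m n"
    using U(1) by (auto simp: unitary_mat_def)
  \<comment> \<open>\<open>d i\<close> is the squared norm of \<open>mat_adjoint A\<close> applied
    to column \<open>i\<close> of \<open>U\<close>.\<close>
  have d: "0 \<le> d i" if "i < n" for i
  proof -
    let ?x = "U *\<^sub>v unit_vec n i"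
    have x: "?x \<in> carrier_vec n" using Uc by auto
    have "mat_adjoint U *\<^sub>v ?x = unit_vec n i"
      using assoc_mult_mat_vec[of "mat_adjoint U" n n U n "unit_vec n i"] Uc UU by simp
    then have "sqnorm (mat_adjoint A *\<^sub>v ?x) = (\<Sum>j<n. d j * (cmod (unit_vec n i $ j))\<^sup>2)"
      using sqnorm_adj_spectral[OF Ac U x] by simp
    also have "\<dots> = (\<Sum>j<n. if j = i then d j else 0)"
      by (intro sum.cong) (use that in auto)
    also have "\<dots> = d i" using that by simp
    finally show ?thesis using sqnorm_nonneg[of "mat_adjoint A *\<^sub>v ?x"] by simp
  qed
  define xs where "xs = map (\<lambda>i. sqrt (d i)) [0..<n]"
  have sv: "singular_values A = rev (sort xs)" using singular_values_eq_sort[OF cp] by (simp add: xs_def)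
  have len: "length xs = n" by (simp add: xs_def)
  have nth: "sing_val A (Suc i) = rev (sort xs) ! i" for i by (simp add: sing_val_def sv)
  show "0 \<le> sing_val A (Suc i)" if "i < n" for i
  proof -
    have "sing_val A (Suc i) \<in> set (rev (sort xs))" unfolding nth using that len by (intro nth_mem) simp
    then show ?thesis using d by (auto simp: xs_def)
  qed
  show "antimono_on {..<n} (\<lambda>i. sing_val A (Suc i))"
    unfolding nth using len by (auto simp: monotone_on_def rev_nth intro!: sorted_nth_mono)
  let ?f = "\<lambda>s. [:- complex_of_real (s\<^sup>2), 1:]"
  \<comment> \<open>As a product over a multiset, the polynomial does not see the sorting.\<close>
  have *: "prod_list (map ?f ys) = prod_mset (image_mset ?f (mset ys))" for ys
    by (simp add: prod_mset_prod_list flip: mset_map)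
  have "(\<Prod>i<n. ?f (sing_val A (Suc i))) = (\<Prod>i\<in>set [0..<n]. ?f (rev (sort xs) ! i))"
    by (simp add: nth atLeast0LessThan)
  also have "\<dots> = prod_list (map ?f (map ((!) (rev (sort xs))) [0..<n]))"
    by (subst prod.distinct_set_conv_list) (auto simp: o_def)
  also have "map ((!) (rev (sort xs))) [0..<n] = rev (sort xs)"
    using map_nth[of "rev (sort xs)"] len by simp
  also have "prod_list (map ?f (rev (sort xs))) = prod_list (map ?f xs)" unfolding * by simp
  also have "\<dots> = (\<Prod>i\<in>set [0..<n]. [:- complex_of_real (d i), 1:])"
    by (subst prod.distinct_set_conv_list)
      (use d in \<open>auto simp: xs_def o_def simp flip: of_real_power intro!: arg_cong[where f = prod_list]\<close>)
  finally show "char_poly (A * mat_adjoint A) = (\<Prod>i<n. ?f (sing_val A (Suc i)))"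
    unfolding cp by (simp add: atLeast0LessThan)
qed

lemma singular_spectral:
  assumes A: "A \<in> K_mat K n m"
  obtains U where "U \<in> K_mat K n n" "unitary_mat n U"
    "A * mat_adjoint A = U * rdiag n (\<lambda>i. (sing_val A (Suc i))\<^sup>2) * mat_adjoint U"
  using hermitian_spectral_ordered[OF gram_hermitian[OF A] sing_val_char_poly(1)[OF A]] .

text \<open>Only coordinates with index at least \<open>p\<close> survive in the weighted sum, and
  there the weights are at most the one at \<open>p\<close>. This is the easy half of the min-max
  principle.\<close>

lemma sqnorm_adj_le:
  assumes A: "A \<in> K_mat K n m" and U: "unitary_mat n U"
    and eq: "A * mat_adjoint A = U * rdiag n (\<lambda>i. (sing_val A (Suc i))\<^sup>2) * mat_adjoint U"
    and x: "x \<in> carrier_vec n" and "p < n" and zero: "\<And>j. j < p \<Longrightarrow> (mat_adjoint U *\<^sub>v x) $ j = 0"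
  shows "sqnorm (mat_adjoint A *\<^sub>v x) \<le> (sing_val A (Suc p))\<^sup>2 * sqnorm x"
proof -
  let ?y = "mat_adjoint U *\<^sub>v x"
  have Uc: "U \<in> carrier_mat n n" using U by (simp add: unitary_mat_def)
  have "sqnorm (mat_adjoint A *\<^sub>v x) = (\<Sum>i<n. (sing_val A (Suc i))\<^sup>2 * (cmod (?y $ i))\<^sup>2)"
    by (rule sqnorm_adj_spectral[OF K_mat_carrier[OF A] U eq x])
  also have "\<dots> \<le> (\<Sum>i<n. (sing_val A (Suc p))\<^sup>2 * (cmod (?y $ i))\<^sup>2)"
  proof (rule sum_mono)
    fix i assume i: "i \<in> {..<n}"
    show "(sing_val A (Suc i))\<^sup>2 * (cmod (?y $ i))\<^sup>2 \<le> (sing_val A (Suc p))\<^sup>2 * (cmod (?y $ i))\<^sup>2"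
    proof (cases "i < p")
      case False
      then have "sing_val A (Suc i) \<le> sing_val A (Suc p)"
        using monotone_onD[OF sing_val_char_poly(2)[OF A], of p i] i \<open>p < n\<close> by simp
      then show ?thesis using sing_val_char_poly(3)[OF A, of i] i by (auto intro!: mult_right_mono power_mono)
    qed (simp add: zero)
  qed
  also have "\<dots> = (sing_val A (Suc p))\<^sup>2 * sqnorm ?y" using Uc by (simp add: sqnorm_def sum_distrib_left)
  finally show ?thesis using sqnorm_unitary_adj[OF U x] by simp
qed

text \<open>The mirror image of \<open>sqnorm_adj_le\<close>: the surviving coordinates have index
  at most \<open>p\<close>, where the weights are at least the one at \<open>p\<close>.\<close>

lemma sqnorm_adj_ge:
  assumes A: "A \<in> K_mat K n m" and U: "unitary_mat n U"
    and eq: "A * mat_adjoint A = U * rdiag n (\<lambda>i. (sing_val A (Suc i))\<^sup>2) * mat_adjoint U"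
    and x: "x \<in> carrier_vec n" and "p < n" and zero: "\<And>j. p < j \<Longrightarrow> j < n \<Longrightarrow> (mat_adjoint U *\<^sub>v x) $ j = 0"
  shows "(sing_val A (Suc p))\<^sup>2 * sqnorm x \<le> sqnorm (mat_adjoint A *\<^sub>v x)"
proof -
  let ?y = "mat_adjoint U *\<^sub>v x"
  have Uc: "U \<in> carrier_mat n n" using U by (simp add: unitary_mat_def)
  have "(sing_val A (Suc p))\<^sup>2 * sqnorm x = (sing_val A (Suc p))\<^sup>2 * sqnorm ?y"
    using sqnorm_unitary_adj[OF U x] by simp
  also have "\<dots> = (\<Sum>i<n. (sing_val A (Suc p))\<^sup>2 * (cmod (?y $ i))\<^sup>2)" using Uc by (simp add: sqnorm_def sum_distrib_left)
  also have "\<dots> \<le> (\<Sum>i<n. (sing_val A (Suc i))\<^sup>2 * (cmod (?y $ i))\<^sup>2)"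
  proof (rule sum_mono)
    fix i assume i: "i \<in> {..<n}"
    show "(sing_val A (Suc p))\<^sup>2 * (cmod (?y $ i))\<^sup>2 \<le> (sing_val A (Suc i))\<^sup>2 * (cmod (?y $ i))\<^sup>2"
    proof (cases "p < i")
      case False
      then have "sing_val A (Suc p) \<le> sing_val A (Suc i)"
        using monotone_onD[OF sing_val_char_poly(2)[OF A], of i p] i \<open>p < n\<close> by simp
      then show ?thesis using sing_val_char_poly(3)[OF A \<open>p < n\<close>] i by (auto intro!: mult_right_mono power_mono)
    qed (use i in \<open>simp add: zero\<close>)
  qed
  also have "\<dots> = sqnorm (mat_adjoint A *\<^sub>v x)"
    by (rule sqnorm_adj_spectral[OF K_mat_carrier[OF A] U eq x, symmetric])
  finally show ?thesis .
qed

lemma sing_val_dual_ge: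
  assumes P: "\<Phi> \<in> K_mat K n m" and Q: "\<Psi> \<in> K_mat K n m" and dual: "\<Psi> * mat_adjoint \<Phi> = 1\<^sub>m n"
    and ip: "Suc (i + p) = n"
  shows "1 \<le> sing_val \<Psi> (Suc i) * sing_val \<Phi> (Suc p)"
proof -
  obtain U where U: "U \<in> K_mat K n n" "unitary_mat n U"
    "\<Phi> * mat_adjoint \<Phi> = U * rdiag n (\<lambda>i. (sing_val \<Phi> (Suc i))\<^sup>2) * mat_adjoint U"
    using singular_spectral[OF P] .
  obtain V where V: "V \<in> K_mat K n n" "unitary_mat n V"
    "\<Psi> * mat_adjoint \<Psi> = V * rdiag n (\<lambda>i. (sing_val \<Psi> (Suc i))\<^sup>2) * mat_adjoint V"
    using singular_spectral[OF Q] .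
  \<comment> \<open>Row \<open>j\<close> of \<open>mat_adjoint V\<close> tests orthogonality to
    column \<open>j\<close> of \<open>V\<close>. The leading \<open>i\<close> rows for
    \<open>\<Psi>\<close> and \<open>p\<close> rows for \<open>\<Phi>\<close> are
    \<open>n - 1\<close> equations in \<open>n\<close> unknowns.\<close>
  define A where "A = mat (i + p) n (\<lambda>(j, k). if j < i then mat_adjoint V $$ (j, k) else mat_adjoint U $$ (j - i, k))"
  have A: "A \<in> K_mat K (i + p) n"
    using ip K_mat_adj[OF V(1)] K_mat_adj[OF U(1)] unfolding A_def K_mat_def by auto
  obtain x where x: "x \<in> K_vec K n" "x \<noteq> 0\<^sub>v n" "A *\<^sub>v x = 0\<^sub>v (i + p)"
    using K_underdetermined[OF A] ip by auto
  have xc: "x \<in> carrier_vec n" using x(1) by (rule K_vec_carrier)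
  have Uc: "mat_adjoint U \<in> carrier_mat n n" and Vc: "mat_adjoint V \<in> carrier_mat n n" and Ac: "A \<in> carrier_mat (i + p) n"
    using U V A by (auto simp: K_mat_def)
  have Vx: "(mat_adjoint V *\<^sub>v x) $ j = 0" if "j < i" for j
  proof -
    have "(mat_adjoint V *\<^sub>v x) $ j = (A *\<^sub>v x) $ j"
      using that ip by (simp add: mult_mat_vec_index[OF Vc xc] mult_mat_vec_index[OF Ac xc]) (simp add: A_def)
    then show ?thesis using x(3) that by simp
  qed
  have Ux: "(mat_adjoint U *\<^sub>v x) $ j = 0" if "j < p" for j
  proof -
    have "(mat_adjoint U *\<^sub>v x) $ j = (A *\<^sub>v x) $ (i + j)"
      using that ip by (simp add: mult_mat_vec_index[OF Uc xc] mult_mat_vec_index[OF Ac xc]) (simp add: A_def)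
    then show ?thesis using x(3) that by simp
  qed
  let ?s = "sing_val \<Psi> (Suc i)" and ?t = "sing_val \<Phi> (Suc p)"
  have s: "0 \<le> ?s" "0 \<le> ?t" using sing_val_char_poly(3)[OF Q, of i] sing_val_char_poly(3)[OF P, of p] ip by auto
  have pos: "0 < sqnorm x" by (rule sqnorm_pos[OF xc x(2)])
  have Pc: "\<Phi> \<in> carrier_mat n m" and Qc: "\<Psi> \<in> carrier_mat n m" using P Q by (auto simp: K_mat_def)
  have "complex_of_real (sqnorm x) = (mat_adjoint \<Psi> *\<^sub>v x) \<bullet>c (mat_adjoint \<Phi> *\<^sub>v x)"
    using dual_inner[OF Pc Qc dual xc xc] sqnorm_cscalar by simp
  then have "sqnorm x = cmod ((mat_adjoint \<Psi> *\<^sub>v x) \<bullet>c (mat_adjoint \<Phi> *\<^sub>v x))"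
    using pos by (metis norm_of_real abs_of_pos)
  also have "\<dots> \<le> sqrt (sqnorm (mat_adjoint \<Psi> *\<^sub>v x)) * sqrt (sqnorm (mat_adjoint \<Phi> *\<^sub>v x))"
    using Pc Qc xc by (intro cauchy_schwarz_vec[of _ m]) auto
  also have "\<dots> \<le> sqrt (?s\<^sup>2 * sqnorm x) * sqrt (?t\<^sup>2 * sqnorm x)"
    using sqnorm_adj_le[OF Q V(2,3) xc _ Vx] sqnorm_adj_le[OF P U(2,3) xc _ Ux] ip
    by (intro mult_mono real_sqrt_le_mono) auto
  also have "\<dots> = ?s * ?t * sqnorm x" using s pos by (simp add: real_sqrt_mult)
  finally show ?thesis using pos by simp
qed

text \<open>
  The test vector is a pair \<open>(x, z)\<close> with \<open>\<Psi>\<^sup>* x = \<Phi>\<^sup>* z\<close>, a system of \<open>m\<close> equations in \<open>2 n\<close> unknowns.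
\<close>

lemma sing_val_dual_le:
  assumes P: "\<Phi> \<in> K_mat K n m" and Q: "\<Psi> \<in> K_mat K n m" and dual: "\<Psi> * mat_adjoint \<Phi> = 1\<^sub>m n"
    and ip: "Suc (i + p) = m" and i: "i < n" and p: "p < n"
  shows "sing_val \<Psi> (Suc i) * sing_val \<Phi> (Suc p) \<le> 1"
proof -
  obtain U where U: "U \<in> K_mat K n n" "unitary_mat n U"
    "\<Phi> * mat_adjoint \<Phi> = U * rdiag n (\<lambda>i. (sing_val \<Phi> (Suc i))\<^sup>2) * mat_adjoint U"
    using singular_spectral[OF P] .
  obtain V where V: "V \<in> K_mat K n n" "unitary_mat n V"
    "\<Psi> * mat_adjoint \<Psi> = V * rdiag n (\<lambda>i. (sing_val \<Psi> (Suc i))\<^sup>2) * mat_adjoint V"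
    using singular_spectral[OF Q] .
  have Pc: "\<Phi> \<in> carrier_mat n m" and Qc: "\<Psi> \<in> carrier_mat n m" using P Q by (auto simp: K_mat_def)
  \<comment> \<open>The numbers of singular vectors beyond positions \<open>i\<close> and
    \<open>p\<close>. As \<open>i + p = m - 1\<close>, the system has
    \<open>m + a + b = 2 * n - 1\<close> equations, one fewer than unknowns.\<close>
  define a b where "a = n - Suc i" and "b = n - Suc p"
  define A where "A = mat (m + a + b) (n + n) (\<lambda>(j, k).
    if j < m then (if k < n then mat_adjoint \<Psi> $$ (j, k) else - mat_adjoint \<Phi> $$ (j, k - n))
    else if j < m + a then (if k < n then mat_adjoint V $$ (Suc i + (j - m), k) else 0)
    else (if k < n then 0 else mat_adjoint U $$ (Suc p + (j - m - a), k - n)))"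
  have Uc: "mat_adjoint U \<in> carrier_mat n n" and Vc: "mat_adjoint V \<in> carrier_mat n n"
    and Psc: "mat_adjoint \<Psi> \<in> carrier_mat m n" and Phc: "mat_adjoint \<Phi> \<in> carrier_mat m n"
    using U V Pc Qc by (auto simp: K_mat_def)
  have neg: "- x \<in> K" if "x \<in> K" for x using K_diff[OF K_zero that] by simp
  have A: "A \<in> K_mat K (m + a + b) (n + n)"
    using i p K_mat_index[OF K_mat_adj[OF V(1)]] K_mat_index[OF K_mat_adj[OF U(1)]]
      K_mat_index[OF K_mat_adj[OF P]] K_mat_index[OF K_mat_adj[OF Q]]
    unfolding A_def K_mat_def a_def b_def by (auto intro!: neg simp del: adj_index)
  have Ac: "A \<in> carrier_mat (m + a + b) (n + n)" by (simp add: A_def)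
  have "m + a + b < n + n" using ip i p by (auto simp: a_def b_def)
  then obtain w where w: "w \<in> K_vec K (n + n)" "w \<noteq> 0\<^sub>v (n + n)" "A *\<^sub>v w = 0\<^sub>v (m + a + b)"
    using K_underdetermined[OF A] by auto
  have wc: "w \<in> carrier_vec (n + n)" using w(1) by (rule K_vec_carrier)
  define x z where "x = vec n (\<lambda>k. w $ k)" and "z = vec n (\<lambda>k. w $ (n + k))"
  have xc: "x \<in> carrier_vec n" and zc: "z \<in> carrier_vec n" by (simp_all add: x_def z_def)
  have Aw: "(\<Sum>k<n. A $$ (j, k) * x $ k) + (\<Sum>k<n. A $$ (j, n + k) * z $ k) = 0" if "j < m + a + b" for j
  proof -
    have "(A *\<^sub>v w) $ j = (\<Sum>k<n. A $$ (j, k) * x $ k) + (\<Sum>k<n. A $$ (j, n + k) * z $ k)"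
      unfolding mult_mat_vec_index[OF Ac wc that] sum_lessThan_add by (simp add: x_def z_def)
    then show ?thesis using w(3) that by simp
  qed
  define y where "y = mat_adjoint \<Psi> *\<^sub>v x"
  have yc: "y \<in> carrier_vec m" using Psc xc by (auto simp: y_def)
  have y': "y = mat_adjoint \<Phi> *\<^sub>v z"
  proof (rule eq_vecI)
    fix j assume "j < dim_vec (mat_adjoint \<Phi> *\<^sub>v z)"
    then have j: "j < m" using Pc by simp
    have "y $ j - (mat_adjoint \<Phi> *\<^sub>v z) $ j = 0"
      using Aw[of j] j by (simp add: y_def mult_mat_vec_index[OF Psc xc] mult_mat_vec_index[OF Phc zc])
        (simp add: A_def sum_negf del: adj_index)
    then show "y $ j = (mat_adjoint \<Phi> *\<^sub>v z) $ j" by simp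
  qed (use yc Pc in auto)
  have Vx: "(mat_adjoint V *\<^sub>v x) $ j = 0" if "i < j" "j < n" for j
  proof -
    define l where "l = j - Suc i"
    have l: "j = Suc i + l" "l < a" using that by (auto simp: l_def a_def)
    show ?thesis
      using Aw[of "m + l"] l that unfolding mult_mat_vec_index[OF Vc xc that(2)]
      by (simp add: A_def del: adj_index)
  qed
  have Uz: "(mat_adjoint U *\<^sub>v z) $ j = 0" if "p < j" "j < n" for j
  proof -
    define l where "l = j - Suc p"
    have l: "j = Suc p + l" "l < b" using that by (auto simp: l_def b_def)
    show ?thesis
      using Aw[of "m + a + l"] l that unfolding mult_mat_vec_index[OF Uc zc that(2)]
      by (simp add: A_def del: adj_index)
  qed
  let ?s = "sing_val \<Psi> (Suc i)" and ?t = "sing_val \<Phi> (Suc p)"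
  have s: "0 \<le> ?s" "0 \<le> ?t" using sing_val_char_poly(3)[OF Q i] sing_val_char_poly(3)[OF P p] by auto
  \<comment> \<open>Duality recovers \<open>x = \<Phi> *\<^sub>v y\<close> and
    \<open>z = \<Psi> *\<^sub>v y\<close>, so \<open>y = 0\<close> would make both halves of
    \<open>w\<close> vanish.\<close>
  have "y \<noteq> 0\<^sub>v m"
  proof
    assume y0: "y = 0\<^sub>v m"
    have "x = \<Phi> *\<^sub>v y" unfolding y_def
      using assoc_mult_mat_vec[OF Pc Psc xc] dual_adj[OF Pc Qc dual] xc by simp
    then have x0: "x = 0\<^sub>v n" using y0 mult_mat_vec_zero[OF Pc] by simp
    have "z = \<Psi> *\<^sub>v y" unfolding y'
      using assoc_mult_mat_vec[OF Qc Phc zc] dual zc by simp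
    then have z0: "z = 0\<^sub>v n" using y0 mult_mat_vec_zero[OF Qc] by simp
    have "w = 0\<^sub>v (n + n)"
    proof (rule eq_vecI)
      fix k assume "k < dim_vec (0\<^sub>v (n + n) :: complex vec)"
      then have k: "k < n + n" by simp
      show "w $ k = 0\<^sub>v (n + n) $ k"
      proof (cases "k < n")
        case True
        then have "w $ k = x $ k" by (simp add: x_def)
        then show ?thesis using True x0 by simp
      next
        case False
        then have "w $ k = z $ (k - n)" using k False by (simp add: z_def)
        then show ?thesis using False k z0 by simp
      qed
    qed (use wc in auto)
    then show False using w(2) by simp
  qed
  then have pos: "0 < sqnorm y" by (rule sqnorm_pos[OF yc])
  have "complex_of_real (sqnorm y) = x \<bullet>c z"
    using dual_inner[OF Pc Qc dual xc zc] sqnorm_cscalar[of y] by (simp flip: y_def y')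
  then have "sqnorm y = cmod (x \<bullet>c z)"
    using pos by (metis norm_of_real abs_of_pos)
  also have "\<dots> \<le> sqrt (sqnorm x) * sqrt (sqnorm z)" by (rule cauchy_schwarz_vec[OF xc zc])
  finally have le: "sqnorm y \<le> sqrt (sqnorm x) * sqrt (sqnorm z)" .
  then have pos2: "0 < sqrt (sqnorm x) * sqrt (sqnorm z)" using pos by linarith
  have ge1: "?s * sqrt (sqnorm x) \<le> sqrt (sqnorm y)"
    using real_sqrt_le_mono[OF sqnorm_adj_ge[OF Q V(2,3) xc i Vx]] s by (simp add: real_sqrt_mult flip: y_def)
  have ge2: "?t * sqrt (sqnorm z) \<le> sqrt (sqnorm y)"
    using real_sqrt_le_mono[OF sqnorm_adj_ge[OF P U(2,3) zc p Uz]] s by (simp add: real_sqrt_mult flip: y')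
  \<comment> \<open>The product of the two lower estimates is at most \<open>sqnorm y\<close>, which
    \<open>le\<close> bounds by the product of the norms of \<open>x\<close> and \<open>z\<close>;
    that product is positive and cancels.\<close>
  have "(?s * sqrt (sqnorm x)) * (?t * sqrt (sqnorm z)) \<le> sqrt (sqnorm y) * sqrt (sqnorm y)"
    by (rule mult_mono[OF ge1 ge2]) (use s in auto)
  then have "?s * ?t * (sqrt (sqnorm x) * sqrt (sqnorm z)) \<le> 1 * (sqrt (sqnorm x) * sqrt (sqnorm z))"
    using le by (simp add: mult_ac)
  then show ?thesis using pos2 by (rule mult_right_le_imp_le)
qed

end

section \<open>Rank-one perturbations\<close>

text \<open>
  In the induction step \<open>mu n\<close> lies between \<open>lam n\<close> and each earlier \<open>lam i\<close>, so \<open>x - mu n\<close> is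
  a convex combination of \<open>x - lam n\<close> and \<open>x - lam i\<close>.
\<close>

lemma interlacing_weights:
  fixes lam mu :: "nat \<Rightarrow> real"
  assumes "\<And>i. i < n \<Longrightarrow> lam i \<le> mu i" and "\<And>i j. i < j \<Longrightarrow> j < n \<Longrightarrow> mu j \<le> lam i"
  shows "\<exists>c :: nat \<Rightarrow> real. (\<forall>i<n. 0 \<le> c i) \<and>
    (\<forall>x :: complex. (\<Prod>i<n. x - mu i) = (\<Prod>i<n. x - lam i) - (\<Sum>i<n. c i * (\<Prod>j\<in>{..<n} - {i}. x - lam j)))"
  using assms
proof (induction n)
  case 0
  show ?case by auto
next
  case (Suc n)
  from Suc.IH[OF Suc.prems(1)[OF less_SucI] Suc.prems(2)[OF _ less_SucI]]
  obtain c :: "nat \<Rightarrow> real" where c: "\<forall>i<n. 0 \<le> c i"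
    "\<forall>x :: complex. (\<Prod>i<n. x - mu i) = (\<Prod>i<n. x - lam i) - (\<Sum>i<n. c i * (\<Prod>j\<in>{..<n} - {i}. x - lam j))"
    by blast
  have le: "lam n \<le> mu n" "\<And>i. i < n \<Longrightarrow> mu n \<le> lam i" using Suc.prems by auto
  \<comment> \<open>The coefficient that expresses \<open>mu n\<close> as a convex combination of
    \<open>lam n\<close> and \<open>lam i\<close>. If these two coincide, \<open>mu n\<close> equals
    both and \<open>0\<close> serves.\<close>
  define b where "b i = (if lam i = lam n then 0 else (mu n - lam n) / (lam i - lam n))" for i
  have b: "0 \<le> b i" "b i \<le> 1" "(1 - b i) * lam n + b i * lam i = mu n" if "i < n" for i
  proof -
    have *: "lam n \<le> mu n" "mu n \<le> lam i" using le that by auto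
    then show "0 \<le> b i" "b i \<le> 1" by (auto simp: b_def divide_simps)
    show "(1 - b i) * lam n + b i * lam i = mu n"
    proof (cases "lam i = lam n")
      case True
      then show ?thesis using * by (simp add: b_def)
    next
      case False
      then have "b i * (lam i - lam n) = mu n - lam n" by (simp add: b_def)
      then show ?thesis by (simp add: algebra_simps)
    qed
  qed
  \<comment> \<open>Index \<open>n\<close> collects all multiples of the full product
    \<open>P\<close> over the old indices: the shift from \<open>lam n\<close> to
    \<open>mu n\<close>, and the part \<open>b i\<close> split off from each old weight.\<close>
  define c' where "c' i = (if i = n then (mu n - lam n) + (\<Sum>i<n. c i * b i) else (1 - b i) * c i)" for i
  have "\<forall>i<Suc n. 0 \<le> c' i"
    using c(1) b le by (auto simp: c'_def less_Suc_eq intro!: add_nonneg_nonneg sum_nonneg)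
  moreover have "(\<Prod>i<Suc n. x - mu i) = (\<Prod>i<Suc n. x - lam i)
    - (\<Sum>i<Suc n. c' i * (\<Prod>j\<in>{..<Suc n} - {i}. x - lam j))" for x :: complex
  proof -
    define P where "P = (\<Prod>i<n. x - lam i)"
    define Q where "Q i = (\<Prod>j\<in>{..<n} - {i}. x - lam j)" for i
    \<comment> \<open>Multiplying by \<open>x - lam i\<close> instead of dividing by it keeps the
      identity valid at the roots and for repeated \<open>lam i\<close>.\<close>
    have PQ: "P = (x - lam i) * Q i" if "i < n" for i
      unfolding P_def Q_def using that by (subst prod.remove[of _ i]) auto
    have Q1: "(\<Prod>j\<in>{..<Suc n} - {i}. x - lam j) = (x - lam n) * Q i" if "i < n" for i
    proof -
      have "{..<Suc n} - {i} = insert n ({..<n} - {i})" using that by auto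
      then show ?thesis by (simp add: Q_def)
    qed
    have Q2: "(\<Prod>j\<in>{..<Suc n} - {n}. x - lam j) = P"
    proof -
      have "{..<Suc n} - {n} = {..<n}" by auto
      then show ?thesis by (simp add: P_def)
    qed
    have split: "(x - mu n) * Q i = (1 - b i) * ((x - lam n) * Q i) + b i * P" if "i < n" for i
    proof -
      have "complex_of_real (mu n) = (1 - b i) * lam n + b i * lam i"
        by (simp flip: b(3)[OF that])
      then have "x - mu n = (1 - b i) * (x - lam n) + b i * (x - lam i)" by (simp add: algebra_simps)
      then show ?thesis unfolding PQ[OF that] by (simp add: distrib_right mult.assoc)
    qed
    define S where "S = (\<Sum>i<n. (1 - b i) * c i * ((x - lam n) * Q i))"
    define T where "T = (\<Sum>i<n. c i * b i)"
    have "(\<Prod>i<Suc n. x - mu i) = (x - mu n) * (P - (\<Sum>i<n. c i * Q i))"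
      using c(2) by (simp add: P_def Q_def)
    also have "\<dots> = (x - mu n) * P - (\<Sum>i<n. c i * ((x - mu n) * Q i))"
      by (simp add: right_diff_distrib sum_distrib_left mult_ac)
    also have "(\<Sum>i<n. c i * ((x - mu n) * Q i)) = (\<Sum>i<n. c i * ((1 - b i) * ((x - lam n) * Q i) + b i * P))"
      by (intro sum.cong refl) (simp add: split)
    also have "\<dots> = S + T * P"
      by (simp add: S_def T_def distrib_left sum.distrib sum_distrib_left mult_ac)
    finally have 1: "(\<Prod>i<Suc n. x - mu i) = (x - mu n) * P - (S + T * P)" .
    have 2: "(\<Sum>i<Suc n. c' i * (\<Prod>j\<in>{..<Suc n} - {i}. x - lam j)) = S + (mu n - lam n + T) * P"
      by (simp add: Q1 Q2 c'_def S_def T_def)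
    have 3: "(\<Prod>i<Suc n. x - lam i) = (x - lam n) * P" by (simp add: P_def)
    show ?thesis unfolding 1 2 3 by (simp add: algebra_simps)
  qed
  ultimately show ?case by blast
qed

text \<open>The matrix determinant lemma. The bordered matrix \<open>X\<close> is reduced to block
  triangular form in two ways, by its corner entry \<open>1\<close> and by its diagonal block
  \<open>D\<close>; the two Schur complements give both sides.\<close>

lemma det_diag_minus_rank_one:
  fixes a v w :: "nat \<Rightarrow> complex"
  assumes a: "\<And>i. i < n \<Longrightarrow> a i \<noteq> 0"
  shows "det (mat n n (\<lambda>(i, j). (if i = j then a i else 0) - v i * w j))
    = (\<Prod>i<n. a i) - (\<Sum>i<n. v i * w i * (\<Prod>j\<in>{..<n} - {i}. a j))"
proof -
  define D where "D = mat n n (\<lambda>(i, j). if i = j then a i else 0)"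
  define V where "V = mat n 1 (\<lambda>(i, j). v i)"
  define W where "W = mat 1 n (\<lambda>(i, j). w j)"
  \<comment> \<open>This is \<open>- W\<close> times the inverse of \<open>D\<close>, the multiplier
    that clears \<open>W\<close> by row operations.\<close>
  define W' where "W' = mat 1 n (\<lambda>(i, j). - w j / a j)"
  define X where "X = four_block_mat D V W (1\<^sub>m 1)"
  have c [simp]: "D \<in> carrier_mat n n" "V \<in> carrier_mat n 1" "W \<in> carrier_mat 1 n" "W' \<in> carrier_mat 1 n"
    by (auto simp: D_def V_def W_def W'_def)
  have detD: "det D = (\<Prod>i<n. a i)"
  proof -
    have "det D = prod_list (diag_mat D)"
      by (rule det_upper_triangular[of _ n]) (auto simp: D_def)
    then show ?thesis by (simp add: prod_list_diag_prod D_def atLeast0LessThan)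
  qed
  let ?L = "mat n n (\<lambda>(i, j). (if i = j then a i else 0) - v i * w j)"
  let ?A = "four_block_mat (1\<^sub>m n) (0\<^sub>m n 1) (- W) (1\<^sub>m 1)"
  let ?B = "four_block_mat (1\<^sub>m n) (0\<^sub>m n 1) W' (1\<^sub>m 1)"
  have Xc: "X \<in> carrier_mat (n + 1) (n + 1)" and Ac: "?A \<in> carrier_mat (n + 1) (n + 1)"
    and Bc: "?B \<in> carrier_mat (n + 1) (n + 1)"
    unfolding X_def by (intro four_block_carrier_mat c one_carrier_mat)+
  have detA: "det ?A = 1" and detB: "det ?B = 1"
    using det_four_block_mat_upper_right_zero[of "1\<^sub>m n" n "0\<^sub>m n 1" 1 "- W" "1\<^sub>m 1"]
      det_four_block_mat_upper_right_zero[of "1\<^sub>m n" n "0\<^sub>m n 1" 1 W' "1\<^sub>m 1"]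
    by (simp_all add: c(3,4)[simplified])
  have Wn: "- W \<in> carrier_mat 1 n" by (rule uminus_carrier_mat[OF c(3)])
  have VW: "V * - W = mat n n (\<lambda>(i, j). - (v i * w j))"
  proof (rule eq_matI)
    fix i j
    assume "i < dim_row (mat n n (\<lambda>(i, j). - (v i * w j)))" "j < dim_col (mat n n (\<lambda>(i, j). - (v i * w j)))"
    then have ij: "i < n" "j < n" by auto
    then show "(V * - W) $$ (i, j) = mat n n (\<lambda>(i, j). - (v i * w j)) $$ (i, j)"
      unfolding mult_mat_index[OF c(2) Wn ij] by (simp add: V_def W_def)
  qed (simp_all add: V_def W_def)
  \<comment> \<open>Column operations clear \<open>W\<close> against the corner \<open>1\<close> and
    leave the rank-one perturbation of \<open>D\<close> in the upper left block.\<close>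
  have "X * ?A = four_block_mat (D * 1\<^sub>m n + V * - W) (D * 0\<^sub>m n 1 + V * 1\<^sub>m 1)
      (W * 1\<^sub>m n + 1\<^sub>m 1 * - W) (W * 0\<^sub>m n 1 + 1\<^sub>m 1 * 1\<^sub>m 1)"
    unfolding X_def by (rule mult_four_block_mat[of _ n n _ 1 _ 1 _ _ n _ 1]) (auto simp del: One_nat_def)
  also have "D * 1\<^sub>m n + V * - W = ?L"
    by (rule eq_matI) (auto simp: VW D_def)
  also have "W * 1\<^sub>m n + 1\<^sub>m 1 * - W = 0\<^sub>m 1 n"
    by (rule eq_matI) (auto simp: mult_mat_index[of _ 1 1 _ n] simp del: One_nat_def, auto simp: W_def)
  also have "D * 0\<^sub>m n 1 + V * 1\<^sub>m 1 = V"
    by (simp only: right_mult_zero_mat[OF c(1)] right_mult_one_mat[OF c(2)] left_add_zero_mat[OF c(2)])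
  also have "W * 0\<^sub>m n 1 + 1\<^sub>m 1 * 1\<^sub>m 1 = 1\<^sub>m 1"
    by (simp only: right_mult_zero_mat[OF c(3)] right_mult_one_mat[OF one_carrier_mat] left_add_zero_mat[OF one_carrier_mat])
  finally have "det (X * ?A) = det ?L"
    using det_four_block_mat_lower_left_zero[of ?L n V 1 "0\<^sub>m 1 n" "1\<^sub>m 1"] c(2) by (simp del: One_nat_def)
  then have 1: "det X = det ?L" using det_mult[OF Xc Ac] detA by simp
  have WD: "W' * D = - W"
  proof (rule eq_matI)
    fix i j assume "i < dim_row (- W)" "j < dim_col (- W)"
    then have ij: "i < 1" "j < n" by (auto simp: W_def)
    then show "(W' * D) $$ (i, j) = (- W) $$ (i, j)"
      unfolding mult_mat_index[OF c(4) c(1) ij]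
      by (simp add: W'_def D_def W_def a if_distrib[where f = "\<lambda>x. _ * x"] cong: if_cong)
  qed (simp_all add: W'_def D_def W_def)
  have "?B * X = four_block_mat (1\<^sub>m n * D + 0\<^sub>m n 1 * W) (1\<^sub>m n * V + 0\<^sub>m n 1 * 1\<^sub>m 1)
      (W' * D + 1\<^sub>m 1 * W) (W' * V + 1\<^sub>m 1 * 1\<^sub>m 1)"
    unfolding X_def by (rule mult_four_block_mat[of _ n n _ 1 _ 1 _ _ n _ 1]) (auto simp del: One_nat_def)
  also have "W' * D + 1\<^sub>m 1 * W = 0\<^sub>m 1 n"
    by (simp only: WD left_mult_one_mat[OF c(3)] uminus_l_inv_mat[OF c(3)])
  also have "1\<^sub>m n * D + 0\<^sub>m n 1 * W = D"
    by (simp only: left_mult_zero_mat[OF c(3)] left_mult_one_mat[OF c(1)] right_add_zero_mat[OF c(1)])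
  also have "1\<^sub>m n * V + 0\<^sub>m n 1 * 1\<^sub>m 1 = V"
    by (simp only: left_mult_zero_mat[OF one_carrier_mat] left_mult_one_mat[OF c(2)] right_add_zero_mat[OF c(2)])
  finally have "det (?B * X) = det D * det (W' * V + 1\<^sub>m 1 * 1\<^sub>m 1)"
    using det_four_block_mat_lower_left_zero[OF c(1) c(2) refl, of "W' * V + 1\<^sub>m 1 * 1\<^sub>m 1"]
      mult_carrier_mat[OF c(4) c(2)] by (simp del: One_nat_def)
  moreover have "det (W' * V + 1\<^sub>m 1 * 1\<^sub>m 1) = 1 - (\<Sum>i<n. w i / a i * v i)"
    by (subst det_single) (auto simp: mult_mat_index[of _ 1 n _ 1] simp del: One_nat_def, auto simp: W'_def V_def sum_negf)
  ultimately have 2: "det X = (\<Prod>i<n. a i) * (1 - (\<Sum>i<n. w i / a i * v i))"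
    using det_mult[OF Bc Xc] detB detD by simp
  have "(\<Prod>i<n. a i) * (\<Sum>i<n. w i / a i * v i) = (\<Sum>i<n. v i * w i * (\<Prod>j\<in>{..<n} - {i}. a j))"
    unfolding sum_distrib_left
  proof (rule sum.cong[OF refl])
    fix i assume i: "i \<in> {..<n}"
    then have "(\<Prod>i<n. a i) = a i * (\<Prod>j\<in>{..<n} - {i}. a j)" by (subst prod.remove[of _ i]) auto
    then show "(\<Prod>i<n. a i) * (w i / a i * v i) = v i * w i * (\<Prod>j\<in>{..<n} - {i}. a j)"
      using a[of i] i by simp
  qed
  then show ?thesis using 1 2 by (simp add: right_diff_distrib)
qed

text \<open>The assumed identity is the secular equation cleared of denominators. The determinant
  formula yields it away from the numbers \<open>lam i\<close>; two polynomials that agree off a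
  finite set are equal.\<close>

lemma char_poly_rdiag_rank_one:
  fixes c lam mu :: "nat \<Rightarrow> real"
  assumes c: "\<forall>i<n. 0 \<le> c i"
    and eq: "\<forall>x :: complex. (\<Prod>i<n. x - mu i) = (\<Prod>i<n. x - lam i) - (\<Sum>i<n. c i * (\<Prod>j\<in>{..<n} - {i}. x - lam j))"
  defines "s \<equiv> mat n 1 (\<lambda>(i, j). complex_of_real (sqrt (c i)))"
  shows "char_poly (rdiag n lam + s * mat_adjoint s) = (\<Prod>i<n. [:- complex_of_real (mu i), 1:])"
proof -
  let ?M = "rdiag n lam + s * mat_adjoint s"
  let ?q = "\<Prod>i<n. [:- complex_of_real (mu i), 1:]"
  have sc: "s \<in> carrier_mat n 1" by (simp add: s_def)
  have M: "?M \<in> carrier_mat n n" using sc by auto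
  have *: "poly (char_poly ?M - ?q) x = 0" if x: "x \<notin> complex_of_real ` lam ` {..<n}" for x
  proof -
    have "- char_matrix ?M x = mat n n (\<lambda>(i, j). (if i = j then x - lam i else 0)
        - complex_of_real (sqrt (c i)) * complex_of_real (sqrt (c j)))"
      by (rule eq_matI) (use sc in \<open>auto simp: char_matrix_def mult_mat_index[of _ n 1 _ n]\<close>, auto simp: s_def)
    then have "poly (char_poly ?M) x = (\<Prod>i<n. x - lam i)
        - (\<Sum>i<n. complex_of_real (sqrt (c i)) * complex_of_real (sqrt (c i)) * (\<Prod>j\<in>{..<n} - {i}. x - lam j))"
      unfolding char_poly_matrix[OF M] using x by (subst det_diag_minus_rank_one[symmetric]) auto
    also have "\<dots> = (\<Prod>i<n. x - lam i) - (\<Sum>i<n. c i * (\<Prod>j\<in>{..<n} - {i}. x - lam j))"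
      using c by (intro arg_cong2[where f = minus] sum.cong refl) (simp flip: of_real_mult)
    also have "\<dots> = (\<Prod>i<n. x - mu i)" using eq by simp
    finally show ?thesis by (simp add: poly_prod)
  qed
  have "char_poly ?M - ?q = 0"
  proof (rule ccontr)
    assume "char_poly ?M - ?q \<noteq> 0"
    then have "finite {x. poly (char_poly ?M - ?q) x = 0}" by (rule poly_roots_finite)
    moreover have "- (complex_of_real ` lam ` {..<n}) \<subseteq> {x. poly (char_poly ?M - ?q) x = 0}" using * by blast
    ultimately have "finite (- (complex_of_real ` lam ` {..<n}))" by (rule rev_finite_subset)
    then have "finite (UNIV :: complex set)" using finite_compl[of "complex_of_real ` lam ` {..<n}"] by simp
    then show False using infinite_UNIV_char_0 by blast
  qed
  then show ?thesis by simp
qed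

context scalar_field
begin

text \<open>In an eigenbasis \<open>U\<close> of \<open>M\<close> the vector with entries
  \<open>sqrt (c i)\<close> does the job, so \<open>V\<close> is its image under \<open>U\<close>.
  The weights are real, hence \<open>V\<close> stays over \<open>K\<close>.\<close>

lemma rank_one_update:
  assumes M: "M \<in> K_mat K n n" and herm: "mat_adjoint M = M"
    and cp: "char_poly M = (\<Prod>i<n. [:- complex_of_real (lam i), 1:])"
    and "\<And>i. i < n \<Longrightarrow> lam i \<le> mu i" and "\<And>i j. i < j \<Longrightarrow> j < n \<Longrightarrow> mu j \<le> lam i"
  obtains V where "V \<in> K_mat K n 1" "char_poly (M + V * mat_adjoint V) = (\<Prod>i<n. [:- complex_of_real (mu i), 1:])"
proof -
  obtain U where U: "U \<in> K_mat K n n" "unitary_mat n U" and eq: "M = U * rdiag n lam * mat_adjoint U"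
    using hermitian_spectral_ordered[OF M herm cp] .
  obtain c :: "nat \<Rightarrow> real" where c: "\<forall>i<n. 0 \<le> c i"
    "\<forall>x :: complex. (\<Prod>i<n. x - mu i) = (\<Prod>i<n. x - lam i) - (\<Sum>i<n. c i * (\<Prod>j\<in>{..<n} - {i}. x - lam j))"
    using interlacing_weights[of n lam mu] assms(4,5) by blast
  define s where "s = mat n 1 (\<lambda>(i, j). complex_of_real (sqrt (c i)))"
  have s: "s \<in> K_mat K n 1" by (auto simp: s_def K_mat_def)
  have sc: "s \<in> carrier_mat n 1" and Uc: "U \<in> carrier_mat n n" and ssc: "s * mat_adjoint s \<in> carrier_mat n n"
    using s U by (auto simp: K_mat_def)
  let ?R = "rdiag n lam + s * mat_adjoint s"
  have UU: "U * mat_adjoint U = 1\<^sub>m n" "mat_adjoint U * U = 1\<^sub>m n" using U(2) by (auto simp: unitary_mat_def)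
  have "(U * s) * mat_adjoint (U * s) = U * s * (mat_adjoint s * mat_adjoint U)"
    by (simp add: adj_mult[OF Uc sc])
  also have "\<dots> = U * (s * mat_adjoint s) * mat_adjoint U"
    using assoc_mult_mat[of "U * s" n 1 "mat_adjoint s" n "mat_adjoint U" n] assoc_mult_mat[OF Uc sc, of "mat_adjoint s" n]
      Uc sc mult_carrier_mat[OF Uc sc] by simp
  finally have "M + (U * s) * mat_adjoint (U * s) = U * ?R * mat_adjoint U"
    unfolding eq using Uc ssc
    by (simp add: mult_add_distrib_mat[of _ n n _ n] add_mult_distrib_mat[of _ n n _ _ n] mult_carrier_mat[OF Uc])
  then have "similar_mat_wit (M + (U * s) * mat_adjoint (U * s)) ?R U (mat_adjoint U)"
    unfolding similar_mat_wit_def Let_def using Uc sc UU ssc by (auto simp: K_mat_carrier)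
  then have "char_poly (M + (U * s) * mat_adjoint (U * s)) = char_poly ?R"
    by (intro char_poly_similar) (auto simp: similar_mat_def)
  then show thesis
    using that[OF K_mat_mult[OF U(1) s]] char_poly_rdiag_rank_one[OF c] by (simp add: s_def)
qed

text \<open>One rank-one update moves \<open>lam\<close> to an intermediate sequence
  \<open>nu\<close> that interlaces it; \<open>nu\<close> is then close enough to \<open>mu\<close>
  for the remaining updates.\<close>

lemma rank_update:
  assumes M: "M \<in> K_mat K n n" and herm: "mat_adjoint M = M"
    and cp: "char_poly M = (\<Prod>i<n. [:- complex_of_real (lam i), 1:])"
    and "antimono_on {..<n} lam" and mu: "antimono_on {..<n} mu"
    and "\<And>i. i < n \<Longrightarrow> lam i \<le> mu i" and "\<And>i. r \<le> i \<Longrightarrow> i < n \<Longrightarrow> mu i \<le> lam (i - r)"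
  shows "\<exists>V \<in> K_mat K n r. char_poly (M + V * mat_adjoint V) = (\<Prod>i<n. [:- complex_of_real (mu i), 1:])"
  using assms(1-4,6-)
proof (induction r arbitrary: M lam)
  case 0
  have "0\<^sub>m n 0 * mat_adjoint (0\<^sub>m n 0) = (0\<^sub>m n n :: complex mat)" by simp
  then have "M + 0\<^sub>m n 0 * mat_adjoint (0\<^sub>m n 0) = M" using K_mat_carrier[OF 0(1)] by simp
  \<comment> \<open>Without updates the two families of inequalities coincide in index and force
    equality.\<close>
  moreover have "lam i = mu i" if "i < n" for i using 0(5)[of i] 0(6)[of i] that by simp
  ultimately show ?case using 0(3) by (intro bexI[of _ "0\<^sub>m n 0"]) (auto simp: K_mat_def)
next
  case (Suc r)
  have anti: "\<And>i j. i \<le> j \<Longrightarrow> j < n \<Longrightarrow> lam j \<le> lam i" "\<And>i j. i \<le> j \<Longrightarrow> j < n \<Longrightarrow> mu j \<le> mu i"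
    using Suc.prems(4) mu by (auto simp: monotone_on_def)
  \<comment> \<open>The largest sequence that stays below \<open>mu\<close> and still interlaces
    \<open>lam\<close>; index \<open>0\<close> has no upper constraint from
    \<open>lam\<close>.\<close>
  define nu where "nu i = (if i = 0 then mu 0 else min (mu i) (lam (i - 1)))" for i
  have ge: "lam i \<le> nu i" if "i < n" for i
    using Suc.prems(5)[OF that] anti(1)[of "i - 1" i] that by (auto simp: nu_def)
  have le: "nu j \<le> lam i" if "i < j" "j < n" for i j
  proof -
    have "nu j \<le> lam (j - 1)" using that by (simp add: nu_def)
    also have "\<dots> \<le> lam i" using anti(1)[of i "j - 1"] that by simp
    finally show ?thesis .
  qed
  obtain v where v: "v \<in> K_mat K n 1"
    "char_poly (M + v * mat_adjoint v) = (\<Prod>i<n. [:- complex_of_real (nu i), 1:])"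
    using rank_one_update[OF Suc.prems(1-3) ge le] .
  let ?M = "M + v * mat_adjoint v"
  have Mc: "M \<in> carrier_mat n n" and vc: "v * mat_adjoint v \<in> carrier_mat n n"
    using Suc.prems(1) gram_hermitian(1)[OF v(1)] by (auto intro: K_mat_carrier)
  have "\<exists>V \<in> K_mat K n r. char_poly (?M + V * mat_adjoint V) = (\<Prod>i<n. [:- complex_of_real (mu i), 1:])"
  proof (rule Suc.IH[OF _ _ v(2)])
    show "?M \<in> K_mat K n n" by (rule K_mat_add[OF Suc.prems(1) gram_hermitian(1)[OF v(1)]])
    show "mat_adjoint ?M = ?M"
      using adj_add[OF Mc vc] Suc.prems(2) gram_hermitian(2)[OF v(1)] by simp
    show "antimono_on {..<n} nu"
    proof (rule monotone_onI)
      fix i j assume ij: "i \<in> {..<n}" "j \<in> {..<n}" "i \<le> j"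
      show "nu j \<le> nu i"
      proof (cases "i = 0")
        case True
        have "nu j \<le> mu j" by (simp add: nu_def)
        then show ?thesis using True anti(2)[of 0 j] ij by (simp add: nu_def)
      next
        case False
        then show ?thesis using anti(2)[of i j] anti(1)[of "i - 1" "j - 1"] ij
          by (auto simp: nu_def min.coboundedI1 min.coboundedI2)
      qed
    qed
    show "nu i \<le> mu i" if "i < n" for i by (simp add: nu_def)
    \<comment> \<open>The two terms of the minimum are met separately: one by the hypothesis with
      gap \<open>Suc r\<close>, the other by monotonicity of \<open>mu\<close>.\<close>
    show "mu i \<le> nu (i - r)" if "r \<le> i" "i < n" for i
    proof (cases "i = r")
      case True
      then show ?thesis using anti(2)[of 0 i] that by (simp add: nu_def)
    next
      case False
      then have "Suc r \<le> i" using that by simp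
      then have "mu i \<le> lam (i - Suc r)" using Suc.prems(6) that by blast
      moreover have "mu i \<le> mu (i - r)" using anti(2) that by simp
      ultimately show ?thesis using False that by (simp add: nu_def)
    qed
  qed
  then obtain V where V: "V \<in> K_mat K n r"
    "char_poly (?M + V * mat_adjoint V) = (\<Prod>i<n. [:- complex_of_real (mu i), 1:])" by auto
  have Vc: "V \<in> carrier_mat n r" and vc1: "v \<in> carrier_mat n 1" using V v by (auto simp: K_mat_def)
  \<comment> \<open>Placing the columns of \<open>v\<close> and \<open>V\<close> side by side adds
    their Gram matrices.\<close>
  define V' where "V' = mat n (Suc r) (\<lambda>(i, k). if k = 0 then v $$ (i, 0) else V $$ (i, k - 1))"
  have V': "V' \<in> K_mat K n (Suc r)" using V v by (auto simp: V'_def K_mat_def)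
  have V'c: "V' \<in> carrier_mat n (Suc r)" using V' by (rule K_mat_carrier)
  have "V' * mat_adjoint V' = v * mat_adjoint v + V * mat_adjoint V"
  proof (rule eq_matI)
    fix i j assume "i < dim_row (v * mat_adjoint v + V * mat_adjoint V)" "j < dim_col (v * mat_adjoint v + V * mat_adjoint V)"
    then have ij: "i < n" "j < n" using Vc by auto
    have "(V' * mat_adjoint V') $$ (i, j) = (\<Sum>k<Suc r. V' $$ (i, k) * cnj (V' $$ (j, k)))"
      using mult_mat_index[OF V'c adj_carrier[OF V'c] ij] V'c ij by simp
    also have "\<dots> = v $$ (i, 0) * cnj (v $$ (j, 0)) + (\<Sum>k<r. V $$ (i, k) * cnj (V $$ (j, k)))"
      unfolding sum.lessThan_Suc_shift using ij by (simp add: V'_def)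
    also have "\<dots> = (v * mat_adjoint v + V * mat_adjoint V) $$ (i, j)"
      using ij Vc vc1 mult_mat_index[OF Vc adj_carrier[OF Vc] ij] mult_mat_index[OF vc1 adj_carrier[OF vc1] ij] by simp
    finally show "(V' * mat_adjoint V') $$ (i, j) = (v * mat_adjoint v + V * mat_adjoint V) $$ (i, j)" .
  qed (use Vc V'c in auto)
  then have "M + V' * mat_adjoint V' = ?M + V * mat_adjoint V"
    using assoc_add_mat[OF Mc vc, of "V * mat_adjoint V"] Vc by auto
  then show ?case using V(2) V' by (intro bexI[of _ V']) simp_all
qed


section \<open>Frames in terms of singular values, and the two halves of the theorem\<close>

lemma frame_sum:
  assumes "A \<in> K_mat K n m" "x \<in> K_vec K n"
  shows "(\<Sum>i<m. (cmod (x \<bullet>c col A i))\<^sup>2) = sqnorm (mat_adjoint A *\<^sub>v x)"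
    "(\<Sum>k<n. (cmod (x $ k))\<^sup>2) = sqnorm x"
  using sqnorm_adj_frame[OF K_mat_carrier[OF assms(1)] K_vec_carrier[OF assms(2)]]
    K_vec_carrier[OF assms(2)] by (auto simp: sqnorm_def)

text \<open>A non-zero vector killed by \<open>mat_adjoint \<Phi>\<close> would violate the lower
  frame bound. Consequently the truncated \<open>m - n\<close> is a true difference.\<close>

lemma frame_dim_le:
  assumes "is_frame K n m \<Phi>"
  shows "n \<le> m"
proof (rule ccontr)
  assume "\<not> n \<le> m"
  have P: "\<Phi> \<in> K_mat K n m" using assms by (simp add: is_frame_def)
  obtain x where x: "x \<in> K_vec K n" "x \<noteq> 0\<^sub>v n" "mat_adjoint \<Phi> *\<^sub>v x = 0\<^sub>v m"
    using K_underdetermined[OF K_mat_adj[OF P]] \<open>\<not> n \<le> m\<close> by auto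
  obtain a where a: "0 < a" "a * sqnorm x \<le> sqnorm (mat_adjoint \<Phi> *\<^sub>v x)"
    using assms x(1) frame_sum[OF P x(1)] by (auto simp: is_frame_def)
  have "0 < sqnorm x" using sqnorm_pos[OF K_vec_carrier[OF x(1)] x(2)] .
  moreover have "sqnorm (mat_adjoint \<Phi> *\<^sub>v x) = 0" unfolding x(3) by (simp add: sqnorm_def)
  ultimately show False using a mult_pos_pos[of a "sqnorm x"] by linarith
qed

text \<open>The lower frame bound is tested on the left singular vector with index \<open>i\<close>.
  Positivity makes the reciprocals in \<open>dual_bounds\<close> genuine.\<close>

lemma frame_sing_val_pos:
  assumes "is_frame K n m \<Phi>" "i < n"
  shows "0 < sing_val \<Phi> (Suc i)"
proof -
  have P: "\<Phi> \<in> K_mat K n m" using assms by (simp add: is_frame_def)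
  obtain U where U: "U \<in> K_mat K n n" "unitary_mat n U"
    "\<Phi> * mat_adjoint \<Phi> = U * rdiag n (\<lambda>i. (sing_val \<Phi> (Suc i))\<^sup>2) * mat_adjoint U"
    using singular_spectral[OF P] .
  have Uc: "U \<in> carrier_mat n n" using U(1) by (rule K_mat_carrier)
  let ?x = "U *\<^sub>v unit_vec n i"
  have u: "unit_vec n i \<in> K_vec K n" by (auto simp: K_vec_def unit_vec_def)
  have x: "?x \<in> K_vec K n" by (rule K_mult_mat_vec[OF U(1) u])
  have xc: "?x \<in> carrier_vec n" using x by (rule K_vec_carrier)
  have Ux: "mat_adjoint U *\<^sub>v ?x = unit_vec n i"
    using assoc_mult_mat_vec[of "mat_adjoint U" n n U n "unit_vec n i"] Uc U(2)
    by (simp add: unitary_mat_def)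
  have x0: "?x \<noteq> 0\<^sub>v n"
  proof
    assume "?x = 0\<^sub>v n"
    then have "unit_vec n i = (0\<^sub>v n :: complex vec)" using Ux mult_mat_vec_zero[of "mat_adjoint U" n n] Uc by simp
    then show False using \<open>i < n\<close> by (metis index_unit_vec(2) index_zero_vec(1) zero_neq_one)
  qed
  obtain a where a: "0 < a" "a * sqnorm ?x \<le> sqnorm (mat_adjoint \<Phi> *\<^sub>v ?x)"
    using assms x frame_sum[OF P x] by (auto simp: is_frame_def)
  have "sqnorm (mat_adjoint \<Phi> *\<^sub>v ?x) \<le> (sing_val \<Phi> (Suc i))\<^sup>2 * sqnorm ?x"
    by (rule sqnorm_adj_le[OF P U(2,3) xc \<open>i < n\<close>]) (use \<open>i < n\<close> in \<open>simp add: Ux\<close>)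
  moreover have "0 < a * sqnorm ?x" using a(1) sqnorm_pos[OF xc x0] by simp
  ultimately have "0 < (sing_val \<Phi> (Suc i))\<^sup>2 * sqnorm ?x" using a(2) by linarith
  then have "sing_val \<Phi> (Suc i) \<noteq> 0" by auto
  then show ?thesis using sing_val_char_poly(3)[OF P \<open>i < n\<close>] by simp
qed

text \<open>The squares of the smallest and the largest singular value serve as frame bounds. For
  \<open>n = 0\<close> there is no smallest one, but all sums vanish and any constants work.\<close>

lemma is_frameI:
  assumes P: "\<Phi> \<in> K_mat K n m" and pos: "0 < n \<Longrightarrow> 0 < sing_val \<Phi> n"
  shows "is_frame K n m \<Phi>"
proof (cases "n = 0")
  case True
  have "\<exists>A B :: real. 0 < A \<and> A \<le> B" by (intro exI[of _ 1]) simp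
  moreover have "(\<Sum>i<m. (cmod (x \<bullet>c col \<Phi> i))\<^sup>2) = 0" if "x \<in> K_vec K 0" for x
    using that P True by (simp add: cscalar_prod_sum[of _ 0] K_mat_def)
  ultimately show ?thesis using P True by (auto simp: is_frame_def)
next
  case False
  obtain U where U: "U \<in> K_mat K n n" "unitary_mat n U"
    "\<Phi> * mat_adjoint \<Phi> = U * rdiag n (\<lambda>i. (sing_val \<Phi> (Suc i))\<^sup>2) * mat_adjoint U"
    using singular_spectral[OF P] .
  let ?A = "(sing_val \<Phi> (Suc (n - 1)))\<^sup>2" and ?B = "(sing_val \<Phi> (Suc 0))\<^sup>2"
  have "0 < sing_val \<Phi> (Suc (n - 1))" using pos False by simp
  moreover have "sing_val \<Phi> (Suc (n - 1)) \<le> sing_val \<Phi> (Suc 0)"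
    using monotone_onD[OF sing_val_char_poly(2)[OF P], of 0 "n - 1"] False by simp
  ultimately have "0 < ?A" "?A \<le> ?B" by (auto intro: power_mono)
  moreover have "?A * sqnorm x \<le> sqnorm (mat_adjoint \<Phi> *\<^sub>v x)" "sqnorm (mat_adjoint \<Phi> *\<^sub>v x) \<le> ?B * sqnorm x"
    if "x \<in> K_vec K n" for x
    using sqnorm_adj_ge[OF P U(2,3) K_vec_carrier[OF that], of "n - 1"]
      sqnorm_adj_le[OF P U(2,3) K_vec_carrier[OF that], of 0] False by auto
  ultimately show ?thesis unfolding is_frame_def using P frame_sum[OF P]
    by (intro conjI exI[of _ ?A] exI[of _ ?B]) auto
qed

lemma dual_bounds_if_dual:
  assumes frame: "is_frame K n m \<Phi>" and dual: "is_dual_frame K n m \<Phi> \<Psi>"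
  shows "dual_bounds n (m - n) (sing_val \<Phi>) (sing_val \<Psi>)"
proof -
  have P: "\<Phi> \<in> K_mat K n m" and Q: "\<Psi> \<in> K_mat K n m" and eq: "\<Psi> * mat_adjoint \<Phi> = 1\<^sub>m n"
    using frame dual by (auto simp: is_dual_frame_def is_frame_def)
  have nm: "n \<le> m" by (rule frame_dim_le[OF frame])
  have lower: "1 / sing_val \<Phi> (n - i + 1) \<le> sing_val \<Psi> i" if "1 \<le> i" "i \<le> n" for i
  proof -
    have "1 \<le> sing_val \<Psi> (Suc (i - 1)) * sing_val \<Phi> (Suc (n - i))"
      by (rule sing_val_dual_ge[OF P Q eq]) (use that in auto)
    moreover have "0 < sing_val \<Phi> (Suc (n - i))" by (rule frame_sing_val_pos[OF frame]) (use that in auto)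
    ultimately show ?thesis using that by (simp add: divide_le_eq)
  qed
  \<comment> \<open>The shifted index \<open>n - i + (m - n)\<close> lies below \<open>n\<close>
    because \<open>m - n < i\<close>; together with \<open>i - 1\<close> it sums to
    \<open>m - 1\<close>.\<close>
  have upper: "sing_val \<Psi> i \<le> 1 / sing_val \<Phi> (n - i + (m - n) + 1)" if "m - n + 1 \<le> i" "i \<le> n" for i
  proof -
    have "sing_val \<Psi> (Suc (i - 1)) * sing_val \<Phi> (Suc (n - i + (m - n))) \<le> 1"
      by (rule sing_val_dual_le[OF P Q eq]) (use that nm in auto)
    moreover have "0 < sing_val \<Phi> (Suc (n - i + (m - n)))" by (rule frame_sing_val_pos[OF frame]) (use that in auto)
    ultimately show ?thesis using that by (simp add: le_divide_eq)
  qed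
  show ?thesis unfolding dual_bounds_def using lower upper by auto
qed

text \<open>
  The dual frame is \<open>\<Psi> = S\<^sup>-\<^sup>1 \<Phi> + V W\<^sup>*\<close> with \<open>S = \<Phi> \<Phi>\<^sup>*\<close> and \<open>W\<close> an isometry into the kernel of \<open>\<Phi>\<close>, so
  that \<open>\<Psi> \<Psi>\<^sup>* = S\<^sup>-\<^sup>1 + V V\<^sup>*\<close>.
\<close>

lemma dual_frame_with_gram:
  assumes frame: "is_frame K n m \<Phi>"
  obtains T where "T \<in> K_mat K n n" "mat_adjoint T = T"
    "char_poly T = (\<Prod>i<n. [:- complex_of_real (1 / (sing_val \<Phi> (n - i))\<^sup>2), 1:])"
    "\<And>V. V \<in> K_mat K n (m - n) \<Longrightarrow>
      \<exists>\<Psi> \<in> K_mat K n m. \<Psi> * mat_adjoint \<Phi> = 1\<^sub>m n \<and> \<Psi> * mat_adjoint \<Psi> = T + V * mat_adjoint V"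
proof -
  have P: "\<Phi> \<in> K_mat K n m" using frame by (simp add: is_frame_def)
  have Pc: "\<Phi> \<in> carrier_mat n m" using P by (rule K_mat_carrier)
  have Pa: "mat_adjoint \<Phi> \<in> carrier_mat m n" using Pc by simp
  have nm: "n \<le> m" by (rule frame_dim_le[OF frame])
  define s where "s i = (sing_val \<Phi> (Suc i))\<^sup>2" for i
  have s: "0 < s i" if "i < n" for i using frame_sing_val_pos[OF frame that] by (simp add: s_def)
  obtain U where U: "U \<in> K_mat K n n" "unitary_mat n U"
    and eq: "\<Phi> * mat_adjoint \<Phi> = U * rdiag n s * mat_adjoint U"
    using singular_spectral[OF P] unfolding s_def .
  have Uc: "U \<in> carrier_mat n n" and Ua: "mat_adjoint U \<in> carrier_mat n n" using U(1) by (auto simp: K_mat_def)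
  have UU: "U * mat_adjoint U = 1\<^sub>m n" "mat_adjoint U * U = 1\<^sub>m n" using U(2) by (auto simp: unitary_mat_def)
  let ?D = "rdiag n (\<lambda>i. 1 / s i)"
  define T where "T = U * ?D * mat_adjoint U"
  have T: "T \<in> K_mat K n n" unfolding T_def by (intro K_mat_mult[of _ n n] K_mat_adj U(1) K_mat_rdiag)
  have Tc: "T \<in> carrier_mat n n" using T by (rule K_mat_carrier)
  have Therm: "mat_adjoint T = T"
  proof -
    have "mat_adjoint T = U * mat_adjoint (U * ?D)"
      unfolding T_def using adj_mult[of "U * ?D" n n "mat_adjoint U" n] Ua mult_carrier_mat[OF Uc rdiag_carrier] by simp
    also have "mat_adjoint (U * ?D) = ?D * mat_adjoint U" using adj_mult[OF Uc rdiag_carrier] by simp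
    finally show ?thesis unfolding T_def using assoc_mult_mat[OF Uc rdiag_carrier Ua] by simp
  qed
  have DD: "?D * rdiag n s = 1\<^sub>m n" unfolding rdiag_mult
    by (rule rdiag_one) (use s in \<open>metis less_irrefl nonzero_eq_divide_eq\<close>)
  have TS: "T * (\<Phi> * mat_adjoint \<Phi>) = 1\<^sub>m n"
  proof -
    have "T * (\<Phi> * mat_adjoint \<Phi>) = (U * ?D) * (mat_adjoint U * (U * (rdiag n s * mat_adjoint U)))"
      unfolding T_def eq using Uc Ua
      by (simp add: assoc_mult_mat[of _ n n _ n _ n] mult_carrier_mat[of _ n n _ n])
    also have "mat_adjoint U * (U * (rdiag n s * mat_adjoint U)) = rdiag n s * mat_adjoint U"
      using assoc_mult_mat[OF Ua Uc, of "rdiag n s * mat_adjoint U" n] UU Ua mult_carrier_mat[OF rdiag_carrier Ua] by simp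
    also have "(U * ?D) * (rdiag n s * mat_adjoint U) = U * ((?D * rdiag n s) * mat_adjoint U)"
      using Uc Ua by (simp add: assoc_mult_mat[of _ n n _ n _ n] mult_carrier_mat[of _ n n _ n])
    finally show ?thesis using DD UU left_mult_one_mat[OF Ua] by simp
  qed
  have cp: "char_poly T = (\<Prod>i<n. [:- complex_of_real (1 / (sing_val \<Phi> (n - i))\<^sup>2), 1:])"
  proof -
    have "similar_mat_wit T ?D U (mat_adjoint U)"
      unfolding similar_mat_wit_def Let_def using Tc Uc Ua UU T_def by auto
    then have "char_poly T = char_poly ?D" by (intro char_poly_similar) (auto simp: similar_mat_def)
    also have "\<dots> = (\<Prod>i<n. [:- complex_of_real (1 / s i), 1:])" by (rule char_poly_rdiag)
    \<comment> \<open>Reciprocals reverse the order, so the product is reindexed to list the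
      eigenvalues of \<open>T\<close> in non-increasing order.\<close>
    also have "\<dots> = (\<Prod>i<n. [:- complex_of_real (1 / s (n - Suc i)), 1:])"
      by (rule prod.nat_diff_reindex[symmetric])
    also have "\<dots> = (\<Prod>i<n. [:- complex_of_real (1 / (sing_val \<Phi> (n - i))\<^sup>2), 1:])"
      by (intro prod.cong refl) (simp add: s_def Suc_diff_Suc)
    finally show ?thesis .
  qed
  have "orthonormal m 0 (\<lambda>_. 0\<^sub>v m)" by (simp add: orthonormal_def)
  from orthonormal_extend[OF this P, of "m - n"] nm
  obtain w where w: "orthonormal m (m - n) w" "\<forall>j<m - n. \<Phi> *\<^sub>v w j = 0\<^sub>v n" by auto
  define W where "W = mat m (m - n) (\<lambda>(i, j). w j $ i)"
  have W: "W \<in> K_mat K m (m - n)" and WW: "mat_adjoint W * W = 1\<^sub>m (m - n)"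
    unfolding W_def using cols_isometry[OF w(1)] by auto
  have Wc: "W \<in> carrier_mat m (m - n)" and Wa: "mat_adjoint W \<in> carrier_mat (m - n) m" using W by (auto simp: K_mat_def)
  have PW: "\<Phi> * W = 0\<^sub>m n (m - n)"
  proof (rule eq_matI)
    fix i j assume "i < dim_row (0\<^sub>m n (m - n) :: complex mat)" "j < dim_col (0\<^sub>m n (m - n) :: complex mat)"
    then have ij: "i < n" "j < m - n" by auto
    have wj: "w j \<in> carrier_vec m" using w(1) ij by (auto simp: orthonormal_def K_vec_def)
    have "(\<Phi> * W) $$ (i, j) = (\<Phi> *\<^sub>v w j) $ i"
      using ij by (simp add: mult_mat_index[OF Pc Wc] mult_mat_vec_index[OF Pc wj]) (simp add: W_def)
    then show "(\<Phi> * W) $$ (i, j) = 0\<^sub>m n (m - n) $$ (i, j)" using w(2) ij by simp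
  qed (use Pc Wc in auto)
  have WP: "mat_adjoint W * mat_adjoint \<Phi> = 0\<^sub>m (m - n) n"
    using adj_mult[OF Pc Wc] PW by simp
  have "\<exists>\<Psi> \<in> K_mat K n m. \<Psi> * mat_adjoint \<Phi> = 1\<^sub>m n \<and> \<Psi> * mat_adjoint \<Psi> = T + V * mat_adjoint V"
    if V: "V \<in> K_mat K n (m - n)" for V
  proof -
    define L where "L = V * mat_adjoint W"
    have Vc: "V \<in> carrier_mat n (m - n)" and Va: "mat_adjoint V \<in> carrier_mat (m - n) n" using V by (auto simp: K_mat_def)
    have TP: "T * \<Phi> \<in> carrier_mat n m" and L: "L \<in> carrier_mat n m" using Tc Pc Vc Wa by (auto simp: L_def)
    have TPK: "T * \<Phi> + L \<in> K_mat K n m"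
      unfolding L_def by (rule K_mat_add[OF K_mat_mult[OF T P] K_mat_mult[OF V K_mat_adj[OF W]]])
    have LP: "L * mat_adjoint \<Phi> = 0\<^sub>m n n"
      unfolding L_def using assoc_mult_mat[OF Vc Wa Pa] WP Vc by (simp add: right_mult_zero_mat[OF Vc])
    have TPP: "T * \<Phi> * mat_adjoint \<Phi> = 1\<^sub>m n" using assoc_mult_mat[OF Tc Pc Pa] TS by simp
    have dual: "(T * \<Phi> + L) * mat_adjoint \<Phi> = 1\<^sub>m n"
      using add_mult_distrib_mat[OF TP L Pa] LP TPP by simp
    have adjTP: "mat_adjoint (T * \<Phi>) = mat_adjoint \<Phi> * T" using adj_mult[OF Tc Pc] Therm by simp
    have adjL: "mat_adjoint L = W * mat_adjoint V" unfolding L_def using adj_mult[OF Vc Wa] by simp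
    have aTP: "mat_adjoint \<Phi> * T \<in> carrier_mat m n" and aL: "W * mat_adjoint V \<in> carrier_mat m n"
      using Pa Tc Wc Va by auto
    \<comment> \<open>Only the right factor is expanded. Duality collapses the summand with
      \<open>mat_adjoint \<Phi> * T\<close> to \<open>T\<close>; in the other,
      \<open>\<Phi> * W\<close> vanishes and \<open>L * W\<close> is \<open>V\<close>.\<close>
    have "(T * \<Phi> + L) * mat_adjoint (T * \<Phi> + L)
        = (T * \<Phi> + L) * (mat_adjoint \<Phi> * T) + (T * \<Phi> + L) * (W * mat_adjoint V)"
      unfolding adj_add[OF TP L] adjTP adjL
      by (rule mult_add_distrib_mat[OF _ aTP aL]) (use TP L in auto)
    also have "(T * \<Phi> + L) * (mat_adjoint \<Phi> * T) = T"
      using assoc_mult_mat[of "T * \<Phi> + L" n m "mat_adjoint \<Phi>" n T n] dual TP L Pa Tc by simp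
    also have "(T * \<Phi> + L) * (W * mat_adjoint V) = ((T * \<Phi> + L) * W) * mat_adjoint V"
      using assoc_mult_mat[of "T * \<Phi> + L" n m W "m - n" "mat_adjoint V" n] TP L Wc Va by simp
    also have "(T * \<Phi> + L) * W = T * \<Phi> * W + L * W" by (rule add_mult_distrib_mat[OF TP L Wc])
    also have "T * \<Phi> * W = 0\<^sub>m n (m - n)"
      using assoc_mult_mat[OF Tc Pc Wc] PW right_mult_zero_mat[OF Tc] by simp
    also have "L * W = V" unfolding L_def using assoc_mult_mat[OF Vc Wa Wc] WW Vc by simp
    also have "0\<^sub>m n (m - n) + V = V" using Vc by simp
    finally show ?thesis using TPK dual by blast
  qed
  then show thesis using that[OF T Therm cp] by blast
qed

text \<open>Squaring turns \<open>dual_bounds\<close> into the hypotheses of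
  \<open>rank_update\<close> for the Gram matrix \<open>T\<close> of the canonical dual, with
  \<open>m - n\<close> updates available.\<close>

lemma dual_frame_if_dual_bounds:
  assumes frame: "is_frame K n m \<Phi>" and anti: "antimono_on {1..n} \<tau>"
    and bounds: "dual_bounds n (m - n) (sing_val \<Phi>) \<tau>"
  shows "\<exists>\<Psi>. is_dual_frame K n m \<Phi> \<Psi> \<and> (\<forall>i \<in> {1..n}. sing_val \<Psi> i = \<tau> i)"
proof -
  have P: "\<Phi> \<in> K_mat K n m" using frame by (simp add: is_frame_def)
  have pos: "0 < sing_val \<Phi> i" if "1 \<le> i" "i \<le> n" for i
    using frame_sing_val_pos[OF frame, of "i - 1"] that by simp
  have santi: "sing_val \<Phi> j \<le> sing_val \<Phi> i" if "1 \<le> i" "i \<le> j" "j \<le> n" for i j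
    using monotone_onD[OF sing_val_char_poly(2)[OF P], of "i - 1" "j - 1"] that by simp
  \<comment> \<open>The ranges of the two bounds together cover every index, so the lower bound
    holds throughout.\<close>
  have lower: "1 / sing_val \<Phi> (n - i) \<le> \<tau> (Suc i)" if "i < n" for i
    using bounds that unfolding dual_bounds_def
    by (cases "i < m - n") (auto simp: Suc_diff_Suc dest!: bspec[of _ _ "Suc i"])
  have upper: "\<tau> (Suc i) \<le> 1 / sing_val \<Phi> (n - (i - (m - n)))" if "m - n \<le> i" "i < n" for i
  proof -
    have "\<tau> (Suc i) \<le> 1 / sing_val \<Phi> (n - Suc i + (m - n) + 1)"
      using bounds that unfolding dual_bounds_def by auto
    also have "n - Suc i + (m - n) + 1 = n - (i - (m - n))" using that by auto
    finally show ?thesis .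
  qed
  \<comment> \<open>\<open>\<tau>\<close> is an arbitrary real sequence; positivity comes from the
    lower bound and is what makes passing to squares and back harmless.\<close>
  have tpos: "0 < \<tau> (Suc i)" if "i < n" for i
  proof -
    have "0 < 1 / sing_val \<Phi> (n - i)" using pos[of "n - i"] that by simp
    then show ?thesis using lower[OF that] by linarith
  qed
  define lam where "lam i = 1 / (sing_val \<Phi> (n - i))\<^sup>2" for i
  define mu where "mu i = (\<tau> (Suc i))\<^sup>2" for i
  obtain T where T: "T \<in> K_mat K n n" "mat_adjoint T = T"
    "char_poly T = (\<Prod>i<n. [:- complex_of_real (lam i), 1:])"
    and gram: "\<And>V. V \<in> K_mat K n (m - n) \<Longrightarrow>
      \<exists>\<Psi> \<in> K_mat K n m. \<Psi> * mat_adjoint \<Phi> = 1\<^sub>m n \<and> \<Psi> * mat_adjoint \<Psi> = T + V * mat_adjoint V"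
    using dual_frame_with_gram[OF frame] unfolding lam_def by blast
  have lam: "lam i = (1 / sing_val \<Phi> (n - i))\<^sup>2" for i by (simp add: lam_def power_divide)
  have "\<exists>V \<in> K_mat K n (m - n). char_poly (T + V * mat_adjoint V) = (\<Prod>i<n. [:- complex_of_real (mu i), 1:])"
  proof (rule rank_update[OF T])
    show "antimono_on {..<n} lam"
    proof (rule monotone_onI)
      fix i j assume "i \<in> {..<n}" "j \<in> {..<n}" "i \<le> j"
      then have "0 < sing_val \<Phi> (n - i)" "0 < sing_val \<Phi> (n - j)" "sing_val \<Phi> (n - i) \<le> sing_val \<Phi> (n - j)"
        using pos santi by auto
      then show "lam j \<le> lam i" unfolding lam by (intro power_mono divide_left_mono) auto
    qed
    show "antimono_on {..<n} mu"
    proof (rule monotone_onI)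
      fix i j assume "i \<in> {..<n}" "j \<in> {..<n}" "i \<le> j"
      then show "mu j \<le> mu i" unfolding mu_def
        using monotone_onD[OF anti, of "Suc i" "Suc j"] tpos[of j] by (intro power_mono) auto
    qed
    show "lam i \<le> mu i" if "i < n" for i
      unfolding lam mu_def using lower[OF that] pos[of "n - i"] that by (intro power_mono) (auto intro: less_imp_le)
    show "mu i \<le> lam (i - (m - n))" if "m - n \<le> i" "i < n" for i
      unfolding lam mu_def using upper[OF that] tpos[OF that(2)] by (intro power_mono) auto
  qed
  then obtain V where V: "V \<in> K_mat K n (m - n)"
    "char_poly (T + V * mat_adjoint V) = (\<Prod>i<n. [:- complex_of_real (mu i), 1:])" by auto
  obtain \<Psi> where Q: "\<Psi> \<in> K_mat K n m" "\<Psi> * mat_adjoint \<Phi> = 1\<^sub>m n" "\<Psi> * mat_adjoint \<Psi> = T + V * mat_adjoint V"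
    using gram[OF V(1)] by auto
  have sv: "sing_val \<Psi> (Suc i) = \<tau> (Suc i)" if "i < n" for i
  proof (rule sing_val_eqI[where c = "\<lambda>i. \<tau> (Suc i)"])
    show "char_poly (\<Psi> * mat_adjoint \<Psi>) = (\<Prod>i<n. [:- complex_of_real ((\<tau> (Suc i))\<^sup>2), 1:])"
      using V(2) Q(3) by (simp add: mu_def)
    show "antimono_on {..<n} (\<lambda>i. \<tau> (Suc i))"
      using anti by (auto simp: monotone_on_def)
  qed (use tpos that in \<open>auto intro: less_imp_le\<close>)
  have sv': "sing_val \<Psi> i = \<tau> i" if "i \<in> {1..n}" for i
    using sv[of "i - 1"] that by auto
  \<comment> \<open>The smallest singular value of \<open>\<Psi>\<close> is \<open>\<tau> n\<close>,
    which is positive.\<close>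
  have "is_frame K n m \<Psi>"
    using Q(1) sv[of "n - 1"] tpos[of "n - 1"] by (intro is_frameI) auto
  then show ?thesis using Q(2) sv' by (auto simp: is_dual_frame_def)
qed

end

theorem theorem4p6:
  fixes K :: "complex set" and n m r :: nat and \<Phi> :: "complex mat"
  assumes "K = \<real> \<or> K = UNIV"
    and "is_frame K n m \<Phi>"
    and "r = m - n"
  shows "(\<forall>\<Psi>. is_dual_frame K n m \<Phi> \<Psi> \<longrightarrow> dual_bounds n r (sing_val \<Phi>) (sing_val \<Psi>)) \<and>
    (\<forall>\<tau> :: nat \<Rightarrow> real. antimono_on {1..n} \<tau> \<longrightarrow> dual_bounds n r (sing_val \<Phi>) \<tau> \<longrightarrow>
      (\<exists>\<Psi>. is_dual_frame K n m \<Phi> \<Psi> \<and> (\<forall>i \<in> {1..n}. sing_val \<Psi> i = \<tau> i)))"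
proof -
  interpret scalar_field K by standard (rule assms(1))
  show ?thesis
    using dual_bounds_if_dual[OF assms(2)] dual_frame_if_dual_bounds[OF assms(2)]
    unfolding assms(3) by blast
qed

end
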